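(* Let $k,p\in\mathbb{N}$ and $\mathbf m=(m_1,\ldots,m_p)\in\mathbb{N}^p$ with $m_p\ge 2$. Put $|\mathbf m|=m_1+\cdots+m_p$ and $N:=|\mathbf m|-p+k-1$ (so $N\ge 1$). Then $$\sum_{j=1}^{p}(-1)^{j}\,\zeta(m_p,m_{p-1},\ldots,m_j)\sum_{n=1}^\infty\frac{\zeta_n^\star(m_1,\ldots,m_{j-1})}{n^{k}4^n}\binom{2n}{n}-(-1)^p\sum_{n=1}^\infty\frac{\zeta_n^\star(m_1,\ldots,m_p)}{n^{k}4^n}\binom{2n}{n}$$ $$=2^{p+1}\sum_{\sigma_1,\ldots,\sigma_N\in\{\pm1\}}\operatorname{Li}_{(k+1,m_1,\ldots,m_{p-1},m_p-1)^\vee}\bigl(-1,\sigma_1,\sigma_1\sigma_2,\sigma_2\sigma_3,\ldots,\sigma_{N-1}\sigma_N\bigr),$$ and this quantity belongs to $\mathsf{CMZV}^2_{|\mathbf m|+k}$. (The index composition $(k+1,m_1,\ldots,m_{p-1},m_p-1)^\vee$ has exactly $N+1$ components.)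
   Context: $\mathbb{N}$ is the set of positive integers. A composition is a finite sequence of positive integers; $|\mathbf k|$ denotes the sum of its entries. Multiple harmonic star sums: $\zeta_n^\star(k_1,\ldots,k_r)=\sum_{n\ge n_1\ge\cdots\ge n_r\ge1}\frac{1}{n_1^{k_1}\cdots n_r^{k_r}}$, with $\zeta_n^\star(\emptyset)=1$ (so for $j=1$, $\zeta_n^\star(m_1,\ldots,m_{j-1})=1$). Multiple zeta values: $\zeta(k_1,\ldots,k_r)=\sum_{n_1>\cdots>n_r>0}\frac{1}{n_1^{k_1}\cdots n_r^{k_r}}$ for $k_1\ge2$. Colored multiple zeta values: for $N'$th roots of unity $z_1,\ldots,z_r$ and $(k_1,z_1)\ne(1,1)$, $\operatorname{Li}_{k_1,\ldots,k_r}(z_1,\ldots,z_r)=\sum_{n_1>\cdots>n_r>0}\frac{z_1^{n_1}\cdots z_r^{n_r}}{n_1^{k_1}\cdots n_r^{k_r}}$ (the iterated, possibly conditionally convergent, sum, i.e. the limit of the truncations $n_1\le M$ as $M\to\infty$). $\mathsf{CMZV}^{N'}_w$ is the $\mathbb{Q}$-span of all such values of level $N'$ with weight $k_1+\cdots+k_r=w$. Hoffman dual: for a composition $\mathbf m=(m_1,\ldots,m_p)$, the dual $\mathbf m^\vee=(m_1',\ldots,m'_{p'})$ is the unique composition of the same weight $|\mathbf m|$ such that $\{1,2,\ldots,|\mathbf m|-1\}$ is the disjoint union of $\{\sum_{i=1}^j m_i\}_{j=1}^{p-1}$ and $\{\sum_{i=1}^j m'_i\}_{j=1}^{p'-1}$.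 E.g. $(1,1,2,1)^\vee=(3,2)$. *)

theory Defs
  imports "HOL-Analysis.Analysis"
begin

text \<open>Indices \<open>(k\<^sub>1, \<dots>, k\<^sub>r)\<close> and summation tuples \<open>(n\<^sub>1, \<dots>, n\<^sub>r)\<close> are lists; the
  mathematical subscript \<open>i\<close> is the list position \<open>i - 1\<close>.\<close>

definition composition :: "nat list \<Rightarrow> bool" where
  "composition ks \<longleftrightarrow> (\<forall>k\<in>set ks. k \<ge> 1)"

definition zeta_star :: "nat \<Rightarrow> nat list \<Rightarrow> real" where
  "zeta_star n ks =
     (\<Sum>ns | length ns = length ks \<and> sorted_wrt (\<ge>) ns \<and> set ns \<subseteq> {1..n}.
        \<Prod>i<length ks. 1 / real (ns ! i) ^ (ks ! i))"

text \<open>All terms are nonnegative, so the multiple series is rendered as an unordered sum.\<close>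

definition mzv :: "nat list \<Rightarrow> real" where
  "mzv ks =
     (\<Sum>\<^sub>\<infinity>ns | length ns = length ks \<and> sorted_wrt (>) ns \<and> set ns \<subseteq> {1..}.
        \<Prod>i<length ks. 1 / real (ns ! i) ^ (ks ! i))"

text \<open>The series may converge only conditionally, hence the limit of the truncations
  \<open>n\<^sub>1 \<le> M\<close>. It is meant for lists of equal length.\<close>

definition Li_trunc :: "nat \<Rightarrow> nat list \<Rightarrow> complex list \<Rightarrow> complex" where
  "Li_trunc M ks zs =
     (\<Sum>ns | length ns = length ks \<and> sorted_wrt (>) ns \<and> set ns \<subseteq> {1..M}.
        \<Prod>i<length ks. (zs ! i) ^ (ns ! i) / of_nat (ns ! i) ^ (ks ! i))"

definition Li :: "nat list \<Rightarrow> complex list \<Rightarrow> complex" where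
  "Li ks zs = lim (\<lambda>M. Li_trunc M ks zs)"

interpretation rat_complex: vector_space "\<lambda>(q::rat) (x::complex). of_rat q * x"
  by unfold_locales (simp_all add: algebra_simps of_rat_add of_rat_mult)

definition CMZV :: "nat \<Rightarrow> nat \<Rightarrow> complex set" where
  "CMZV L w = rat_complex.span
     {Li ks zs | ks zs. ks \<noteq> [] \<and> composition ks \<and> sum_list ks = w \<and> length zs = length ks \<and>
        (\<forall>z\<in>set zs. z ^ L = 1) \<and> (hd ks, hd zs) \<noteq> (1, 1)}"

text \<open>The partial sums \<open>m\<^sub>1 + \<dots> + m\<^sub>j\<close> for \<open>1 \<le> j \<le> p - 1\<close>; the total sum is excluded.\<close>

definition partial_sums :: "nat list \<Rightarrow> nat set" where
  "partial_sums ms = (\<lambda>j. sum_list (take j ms)) ` {1..<length ms}"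

definition hoffman_dual :: "nat list \<Rightarrow> nat list" where
  "hoffman_dual ms = (THE ms'. composition ms' \<and> sum_list ms' = sum_list ms \<and>
     partial_sums ms \<inter> partial_sums ms' = {} \<and>
     partial_sums ms \<union> partial_sums ms' = {1..<sum_list ms})"

text \<open>The series \<open>\<Sum>\<^sub>n\<^sub>\<ge>\<^sub>1\<close> is indexed from 0 by \<open>n \<mapsto> Suc n\<close>.\<close>

definition binom_series :: "nat \<Rightarrow> nat list \<Rightarrow> real" where
  "binom_series k ms =
     (\<Sum>i. let n = Suc i in
        zeta_star n ms / (real n ^ k * 4 ^ n) * real ((2 * n) choose n))"

end

theory Submission
  imports Defs
begin

text \<open>Write \<open>a\<^sub>n = (2n choose n) / 4\<^sup>n\<close>. The alternating sum of products of zeta values and star sums on the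
  left is an antipode relation: splitting off the largest star index and inducting on the index list
  collapses it to a single tail (lemma \<open>antipode_tail\<close>), so that
    \<open>-Q = \<Sum> a\<^sub>n / (n\<^sup>k n\<^sub>1^m\<^sub>1 \<cdots> n\<^sub>p^m\<^sub>p)\<close>, summed over \<open>1 \<le> n < n\<^sub>1 < \<cdots> < n\<^sub>p\<close>.

  Such a sum is turned into its Hoffman dual by connected sums. The connector
  \<open>c(n, l) = n! l! / (n + l)!\<close> is symmetric and telescopes: the sum of \<open>c(n, l) / l\<close> over \<open>l > b\<close> is
  \<open>c(n, b) / n\<close>. For a weight \<open>f\<close> put \<open>f*(l) = \<Sum> f(n) c(n, l)\<close>. Then dividing \<open>f\<close> by \<open>n\<close> replaces
  \<open>f*(b)\<close> by the sum of \<open>f*(l) / l\<close> over \<open>l > b\<close>, whereas summing \<open>f\<close> over smaller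
  arguments and then dividing by \<open>n\<close> amounts to dividing \<open>f*\<close> by \<open>l\<close>. These two letters are exchanged
  by Hoffman duality, which is how it acts on the word of an index; hence lemma
  \<open>connected_sum_transport\<close>, where one starts from \<open>c(n, 0) = 1\<close>. For \<open>f = a\<close> a hypergeometric telescoping gives
  \<open>a*(l) = 1 / (2l - 1)\<close> (lemma \<open>connect_central\<close>), so \<open>-Q\<close> is the sum of
  \<open>1 / (l (2l - 1))\<close> times a multiple harmonic sum of all but the first entry of the dual index, with
  variables below \<open>l\<close>.

  On the other side, summing over the signs \<open>\<sigma>\<^sub>i\<close> forces all summation variables but the largest
  to be even (lemma \<open>sum_signs_Li_trunc\<close>). The first entry of the dual index is 1 with sign \<open>-1\<close>, and
  pairing \<open>n\<^sub>1 = 2l - 1\<close> with \<open>n\<^sub>1 = 2l\<close> produces \<open>-1 / (2l (2l - 1))\<close>, the same series up to a power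
  of 2. The individual values converge only conditionally; their convergence comes from
  summation by parts and a bound of order \<open>n^(1/4)\<close> for truncated sums (lemma \<open>convergent_Li_trunc\<close>).

  The rearrangements of nonnegative series are carried out in the extended nonnegative reals, where
  the order of summation is immaterial; finiteness is needed only at the two ends.\<close>

section \<open>Hoffman duality as a recursion\<close>

definition is_dual :: "nat list \<Rightarrow> nat list \<Rightarrow> bool" where
  "is_dual ms ms' \<longleftrightarrow> composition ms' \<and> sum_list ms' = sum_list ms \<and>
     partial_sums ms \<inter> partial_sums ms' = {} \<and>
     partial_sums ms \<union> partial_sums ms' = {1..<sum_list ms}"

lemma partial_sums_singleton: "partial_sums [m] = {}"
  by (simp add: partial_sums_def)

lemma partial_sums_Cons:
  assumes "ms \<noteq> []"
  shows "partial_sums (m # ms) = insert m ((+) m ` partial_sums ms)"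
proof -
  have "{1..<length (m # ms)} = insert 1 (Suc ` {1..<length ms})"
    using assms by (auto simp: image_Suc_atLeastLessThan neq_Nil_conv)
  then show ?thesis
    by (simp only: partial_sums_def image_insert image_image) simp
qed

lemma partial_sums_Cons_one:
  "ms \<noteq> [] \<Longrightarrow> partial_sums (1 # ms) = insert 1 (Suc ` partial_sums ms)"
  by (subst partial_sums_Cons) auto

lemma partial_sums_Cons_Suc: "partial_sums (Suc m # ms) = Suc ` partial_sums (m # ms)"
  by (cases "ms = []") (auto simp: partial_sums_singleton partial_sums_Cons image_image)

lemma partial_sums_pos: "composition ms \<Longrightarrow> 0 \<notin> partial_sums ms"
  by (cases ms) (auto simp: partial_sums_def composition_def take_Cons' split: if_splits)

lemma composition_Cons: "composition (m # ms) \<longleftrightarrow> m \<ge> 1 \<and> composition ms"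
  by (auto simp: composition_def)

lemma composition_sum_eq_0: "composition ms \<Longrightarrow> sum_list ms = 0 \<longleftrightarrow> ms = []"
  by (cases ms) (auto simp: composition_def)

lemma is_dual_one: "is_dual [1] ls \<longleftrightarrow> ls = [1]"
proof
  assume *: "is_dual [1] ls"
  then obtain x xs where ls: "ls = x # xs" and "x \<ge> 1" "composition xs" "x + sum_list xs = 1"
    by (cases ls) (auto simp: is_dual_def composition_Cons)
  then have "x = 1" "sum_list xs = 0" by linarith+
  then show "ls = [1]" using ls composition_sum_eq_0[OF \<open>composition xs\<close>] by simp
qed (auto simp: is_dual_def composition_def partial_sums_singleton)

lemma atLeastLessThan_Suc_shift:
  "0 < s \<Longrightarrow> {1..<Suc s} = insert 1 (Suc ` {1..<s})"
  by (auto simp: image_Suc_atLeastLessThan)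

text \<open>Prepending a position that is a break on one side and a continuation on the other preserves
  complementarity. This one fact is behind both recursion rules of the dual.\<close>

lemma complement_shift:
  assumes "0 \<notin> A" "0 \<notin> B" "0 < s"
  shows "insert 1 (Suc ` A) \<inter> Suc ` B = {} \<and> insert 1 (Suc ` A) \<union> Suc ` B = {1..<Suc s} \<longleftrightarrow>
         A \<inter> B = {} \<and> A \<union> B = {1..<s}"
proof -
  have i: "insert 1 (Suc ` A) \<inter> Suc ` B = Suc ` (A \<inter> B)"
    using assms(2) by auto
  have "insert 1 (Suc ` A) \<union> Suc ` B = {1..<Suc s} \<longleftrightarrow>
        insert 1 (Suc ` (A \<union> B)) = insert 1 (Suc ` {1..<s})"
    using assms(3) by (simp only: atLeastLessThan_Suc_shift image_Un Un_insert_left)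
  also have "\<dots> \<longleftrightarrow> Suc ` (A \<union> B) = Suc ` {1..<s}"
    by (rule insert_ident) (use assms in auto)
  also have "\<dots> \<longleftrightarrow> A \<union> B = {1..<s}"
    by (rule inj_image_eq_iff) simp
  finally show ?thesis by (simp only: i image_is_empty)
qed

text \<open>A head of at least 2 means that 1 is not a partial sum, so it must be one of the dual, whose head
  is therefore 1.\<close>

lemma is_dual_Suc:
  assumes "k \<ge> 1" "composition ks"
  shows "is_dual (Suc k # ks) ls \<longleftrightarrow> (\<exists>ls'. ls = 1 # ls' \<and> is_dual (k # ks) ls')"
proof -
  have comp: "composition (k # ks)" using assms by (simp add: composition_Cons)
  have step: "is_dual (Suc k # ks) (1 # ls') \<longleftrightarrow> is_dual (k # ks) ls'" for ls'
  proof (cases "composition ls' \<and> sum_list ls' = sum_list (k # ks)")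
    case True
    then have "ls' \<noteq> []" using assms by auto
    then show ?thesis
      unfolding is_dual_def partial_sums_Cons_Suc partial_sums_Cons_one[OF \<open>ls' \<noteq> []\<close>]
      using complement_shift[of "partial_sums ls'" "partial_sums (k # ks)" "sum_list (k # ks)"]
        partial_sums_pos[OF comp] partial_sums_pos[of ls'] True assms
      by (auto simp: Int_commute Un_commute composition_Cons)
  qed (auto simp: is_dual_def composition_Cons)
  have "\<exists>ls'. ls = 1 # ls'" if dual: "is_dual (Suc k # ks) ls"
  proof (cases ls)
    case Nil
    with dual show ?thesis by (simp add: is_dual_def)
  next
    case (Cons x xs)
    show ?thesis
    proof (cases "x = 1")
      case False
      then obtain y where "x = Suc y" "y \<ge> 1"
        using dual Cons by (cases x) (auto simp: is_dual_def composition_Cons)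
      then have "1 \<notin> partial_sums ls"
        using partial_sums_pos[of "y # xs"] dual Cons
        by (auto simp: partial_sums_Cons_Suc is_dual_def composition_Cons)
      moreover have "1 \<notin> partial_sums (Suc k # ks)"
        using partial_sums_pos[OF comp] by (auto simp: partial_sums_Cons_Suc)
      moreover have "1 \<in> {1..<sum_list (Suc k # ks)}" using assms by auto
      ultimately show ?thesis using dual unfolding is_dual_def by blast
    qed (use Cons in auto)
  qed
  then show ?thesis using step by blast
qed

text \<open>Here 1 is a partial sum, hence not one of the dual, whose head is therefore at least 2.\<close>

lemma is_dual_Cons_one:
  assumes "composition (k # ks)"
  shows "is_dual (1 # k # ks) ls \<longleftrightarrow> (\<exists>x xs. ls = Suc x # xs \<and> is_dual (k # ks) (x # xs))"
proof -
  have step: "is_dual (1 # k # ks) (Suc x # xs) \<longleftrightarrow> is_dual (k # ks) (x # xs)" if "x \<ge> 1" for x xs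
  proof (cases "composition xs \<and> x + sum_list xs = sum_list (k # ks)")
    case True
    then show ?thesis
      unfolding is_dual_def partial_sums_Cons_Suc partial_sums_Cons_one[OF list.distinct(2)]
      using complement_shift[of "partial_sums (k # ks)" "partial_sums (x # xs)" "sum_list (k # ks)"]
        partial_sums_pos[OF assms] partial_sums_pos[of "x # xs"] that assms
      by (auto simp: composition_Cons)
  qed (auto simp: is_dual_def composition_Cons)
  have "\<exists>x xs. ls = Suc x # xs \<and> x \<ge> 1" if dual: "is_dual (1 # k # ks) ls"
  proof (cases ls)
    case Nil
    with dual show ?thesis by (simp add: is_dual_def)
  next
    case (Cons y xs)
    have "y \<noteq> 1"
    proof
      assume "y = 1"
      moreover from this have "xs \<noteq> []"
        using dual Cons assms by (auto simp: is_dual_def composition_Cons)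
      ultimately have "1 \<in> partial_sums ls" using Cons by (simp add: partial_sums_Cons)
      moreover have "1 \<in> partial_sums (1 # k # ks)" by (simp add: partial_sums_Cons)
      ultimately show False using dual unfolding is_dual_def by blast
    qed
    then show ?thesis using dual Cons
      by (cases y) (auto simp: is_dual_def composition_Cons)
  qed
  moreover have "x \<ge> 1" if "is_dual (k # ks) (x # xs)" for x xs
    using that by (simp add: is_dual_def composition_Cons)
  ultimately show ?thesis using step by blast
qed

text \<open>Every composition arises from \<open>[1]\<close> by incrementing the head or prepending a 1. These are the two
  letters that duality exchanges.\<close>

lemma composition_induct [consumes 2, case_names one Suc Cons_one]:
  assumes "composition ks" "ks \<noteq> []"
    and one: "P [1]"
    and Suc: "\<And>k ks. k \<ge> 1 \<Longrightarrow> composition ks \<Longrightarrow> P (k # ks) \<Longrightarrow> P (Suc k # ks)"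
    and Cons_one: "\<And>k ks. composition (k # ks) \<Longrightarrow> P (k # ks) \<Longrightarrow> P (1 # k # ks)"
  shows "P ks"
proof -
  have "P (Suc j # js)" if "composition js" for j js
    using that
  proof (induction js arbitrary: j)
    case Nil
    show ?case using one Suc[of _ "[]"] by (induction j) (auto simp: composition_def)
  next
    case (Cons i js)
    then obtain i' where "i = Suc i'" by (cases i) (auto simp: composition_Cons)
    with Cons have "P (1 # i # js)" by (intro Cons_one) (auto simp: composition_Cons)
    then show ?case using Suc[of _ "i # js"] Cons.prems by (induction j) auto
  qed
  then show ?thesis using assms(1,2)
    by (cases ks; cases "hd ks") (auto simp: composition_Cons)
qed

lemma ex1_is_dual:
  assumes "composition ks" "ks \<noteq> []"
  shows "\<exists>!ls. is_dual ks ls"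
  using assms
proof (induction rule: composition_induct)
  case one
  show ?case by (simp only: is_dual_one) blast
next
  case (Suc k ks)
  then show ?case by (simp only: is_dual_Suc) blast
next
  case (Cons_one k ks)
  then obtain x xs where dual: "is_dual (k # ks) (x # xs)"
    and unique: "\<And>ls. is_dual (k # ks) ls \<Longrightarrow> ls = x # xs"
    by (metis composition_Cons is_dual_def list.exhaust not_one_le_zero sum_list.Nil
        add_is_0 sum_list.Cons)
  show ?case unfolding is_dual_Cons_one[OF Cons_one(1)]
    by (rule ex1I[of _ "Suc x # xs"]) (use dual unique in blast)+
qed

lemma is_dual_hoffman_dual:
  assumes "composition ks" "ks \<noteq> []"
  shows "is_dual ks (hoffman_dual ks)"
  using theI'[OF ex1_is_dual[OF assms]] by (simp only: hoffman_dual_def is_dual_def)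

lemma hoffman_dual_unique:
  assumes "composition ks" "ks \<noteq> []" "is_dual ks ls"
  shows "hoffman_dual ks = ls"
  using ex1_is_dual[OF assms(1,2)] is_dual_hoffman_dual[OF assms(1,2)] assms(3) by blast

lemma hoffman_dual_one: "hoffman_dual [1] = [1]"
  by (rule hoffman_dual_unique) (auto simp: composition_def is_dual_one[simplified])

lemma hoffman_dual_Suc:
  assumes "k \<ge> 1" "composition ks"
  shows "hoffman_dual (Suc k # ks) = 1 # hoffman_dual (k # ks)"
  by (rule hoffman_dual_unique)
     (use assms is_dual_hoffman_dual[of "k # ks"] in \<open>auto simp: is_dual_Suc composition_Cons\<close>)

lemma hoffman_dual_Cons_one:
  assumes "composition (k # ks)" "hoffman_dual (k # ks) = l # ls"
  shows "hoffman_dual (1 # k # ks) = Suc l # ls"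
proof (rule hoffman_dual_unique)
  show "is_dual (1 # k # ks) (Suc l # ls)"
    using assms is_dual_hoffman_dual[of "k # ks"] by (subst is_dual_Cons_one) auto
qed (use assms in \<open>auto simp: composition_Cons\<close>)

lemma
  assumes "composition ks" "ks \<noteq> []"
  shows composition_hoffman_dual: "composition (hoffman_dual ks)"
    and sum_list_hoffman_dual: "sum_list (hoffman_dual ks) = sum_list ks"
    and hoffman_dual_not_Nil: "hoffman_dual ks \<noteq> []"
proof -
  note dual = is_dual_hoffman_dual[OF assms]
  show "composition (hoffman_dual ks)" and sum: "sum_list (hoffman_dual ks) = sum_list ks"
    using dual by (simp_all add: is_dual_def)
  show "hoffman_dual ks \<noteq> []"
    using sum composition_sum_eq_0[OF assms(1)] assms(2) by auto
qed

text \<open>Breaks of the index and of its dual together fill all the inner positions.\<close>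

lemma length_hoffman_dual:
  assumes "composition ks" "ks \<noteq> []"
  shows "length ks + length (hoffman_dual ks) = Suc (sum_list ks)"
  using assms
proof (induction rule: composition_induct)
  case one
  show ?case by (simp add: hoffman_dual_one[simplified])
next
  case (Suc k ks)
  then show ?case by (simp add: hoffman_dual_Suc)
next
  case (Cons_one k ks)
  obtain l ls where l: "hoffman_dual (k # ks) = l # ls"
    using hoffman_dual_not_Nil[OF Cons_one(1)] by (cases "hoffman_dual (k # ks)") auto
  show ?case using Cons_one hoffman_dual_Cons_one[OF Cons_one(1) l] l by simp
qed

section \<open>The connector and its transform\<close>

definition connector :: "nat \<Rightarrow> nat \<Rightarrow> real" where
  "connector n l = fact n * fact l / fact (n + l)"

lemma connector_pos: "connector n l > 0"
  by (simp add: connector_def)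

lemma connector_commute: "connector n l = connector l n"
  by (simp add: connector_def add.commute mult.commute)

lemma connector_0: "connector n 0 = 1"
  by (simp add: connector_def)

lemma connector_Suc: "connector n (Suc l) = connector n l * real (Suc l) / real (Suc (n + l))"
  by (simp add: connector_def mult_ac)

lemma connector_le:
  assumes "n \<ge> 1"
  shows "connector n l \<le> 1 / real (Suc l)"
  using assms
proof (induction n rule: nat_induct_at_least)
  case base
  show ?case by (simp add: connector_def)
next
  case (Suc n)
  have "connector (Suc n) l = connector n l * (real (Suc n) / real (Suc (l + n)))"
    by (simp add: connector_commute[of _ l] connector_Suc)
  also have "\<dots> \<le> connector n l"
    by (rule mult_left_le) (auto intro: less_imp_le[OF connector_pos])
  finally show ?case using Suc.IH by simp
qed

lemma connector_tendsto_0: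
  assumes "n \<ge> 1"
  shows "(\<lambda>l. connector n l) \<longlonglongrightarrow> 0"
proof (rule tendsto_sandwich[OF _ _ tendsto_const LIMSEQ_inverse_real_of_nat])
  show "\<forall>\<^sub>F l in sequentially. connector n l \<le> inverse (real (Suc l))"
    using connector_le[OF assms] by (simp add: inverse_eq_divide)
qed (simp add: less_imp_le[OF connector_pos])

text \<open>The conditional summand stands for a sum over \<open>i \<ge> j\<close>. Keeping all series indexed by the full type
  allows the order of nested sums to be exchanged without shifting indices.\<close>

lemma suminf_telescope_from:
  fixes c F :: "nat \<Rightarrow> real"
  assumes F: "F \<longlonglongrightarrow> 0" and c: "\<And>i. i \<ge> j \<Longrightarrow> c i = F i - F (Suc i)"
    and nonneg: "\<And>i. i \<ge> j \<Longrightarrow> c i \<ge> 0"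
  shows "(\<Sum>i. if j \<le> i then ennreal (c i) else 0) = ennreal (F j)"
proof -
  \<comment> \<open>Constant up to \<open>j\<close>, so that its decrements vanish there.\<close>
  define G where "G i = F (max i j)" for i
  have "G \<longlonglongrightarrow> 0"
    by (rule Lim_transform_eventually[OF F])
       (auto simp: G_def eventually_at_top_linorder intro!: exI[of _ j])
  from telescope_sums'[OF this] have "(\<lambda>i. G i - G (Suc i)) sums F j"
    by (simp add: G_def)
  also have "(\<lambda>i. G i - G (Suc i)) = (\<lambda>i. if j \<le> i then c i else 0)"
    by (auto simp: G_def c max_def le_Suc_eq fun_eq_iff)
  finally have sums: "(\<lambda>i. if j \<le> i then c i else 0) sums F j" .
  have "(\<Sum>i. if j \<le> i then ennreal (c i) else 0) = (\<Sum>i. ennreal (if j \<le> i then c i else 0))"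
    by (intro suminf_cong) auto
  also have "\<dots> = ennreal (F j)"
    by (rule suminf_ennreal_eq[OF _ sums]) (use nonneg in auto)
  finally show ?thesis .
qed

text \<open>By \<open>connector_Suc\<close> the summand is the decrement of \<open>connector n l / n\<close>. Since the connector is symmetric, this
  identity serves for sums over either argument.\<close>

lemma suminf_connector:
  "(\<Sum>j. if b \<le> j then ennreal (connector (Suc i) (Suc j) / Suc j) else 0) =
   ennreal (connector (Suc i) b / Suc i)"
proof (rule suminf_telescope_from)
  show "(\<lambda>l. connector (Suc i) l / real (Suc i)) \<longlonglongrightarrow> 0"
    using connector_tendsto_0[of "Suc i"] by (intro tendsto_divide_zero) simp
next
  fix j
  show "connector (Suc i) (Suc j) / real (Suc j) =
        connector (Suc i) j / real (Suc i) - connector (Suc i) (Suc j) / real (Suc i)"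
    by (simp add: connector_Suc divide_simps del: of_nat_Suc) (simp add: algebra_simps)
qed (simp add: less_imp_le[OF connector_pos])

lemma suminf_swap_ennreal:
  fixes f :: "nat \<Rightarrow> nat \<Rightarrow> ennreal"
  shows "(\<Sum>i. \<Sum>j. f i j) = (\<Sum>j. \<Sum>i. f i j)"
  using nn_integral_fst_count_space[of "case_prod f"] nn_integral_snd_count_space[of "case_prod f"]
  by (simp add: nn_integral_count_space_nat)

text \<open>A positive variable \<open>n\<close> is coded as \<open>Suc i\<close>, so that series run over a whole type.\<close>

definition connect :: "(nat \<Rightarrow> ennreal) \<Rightarrow> nat \<Rightarrow> ennreal" where
  "connect f l = (\<Sum>i. f (Suc i) * ennreal (connector (Suc i) l))"

text \<open>The first letter: each factor \<open>1 / n\<close> absorbed by the connector opens a sum over larger dual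
  variables.\<close>

lemma connect_divide:
  "connect (\<lambda>n. f n * ennreal (1 / n)) b =
   (\<Sum>j. if b \<le> j then connect f (Suc j) * ennreal (1 / Suc j) else 0)"
proof -
  have "connect (\<lambda>n. f n * ennreal (1 / n)) b =
        (\<Sum>i. f (Suc i) * ennreal (connector (Suc i) b / Suc i))"
    unfolding connect_def
    by (intro suminf_cong)
       (simp add: mult.assoc ennreal_mult'[symmetric] less_imp_le[OF connector_pos])
  also have "\<dots> = (\<Sum>i. \<Sum>j. f (Suc i) *
      (if b \<le> j then ennreal (connector (Suc i) (Suc j) / Suc j) else 0))"
    by (simp only: suminf_connector[symmetric] ennreal_suminf_cmult)
  also have "\<dots> = (\<Sum>j. \<Sum>i. f (Suc i) *
      (if b \<le> j then ennreal (connector (Suc i) (Suc j) / Suc j) else 0))"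
    by (rule suminf_swap_ennreal)
  also have "\<dots> = (\<Sum>j. if b \<le> j then connect f (Suc j) * ennreal (1 / Suc j) else 0)"
  proof (intro suminf_cong)
    fix j
    have "(\<Sum>i. f (Suc i) * ennreal (connector (Suc i) (Suc j) / Suc j)) =
          (\<Sum>i. f (Suc i) * ennreal (connector (Suc i) (Suc j)) * ennreal (1 / Suc j))"
      by (intro suminf_cong)
         (simp add: mult.assoc ennreal_mult'[symmetric] less_imp_le[OF connector_pos])
    then show "(\<Sum>i. f (Suc i) *
        (if b \<le> j then ennreal (connector (Suc i) (Suc j) / Suc j) else 0)) =
        (if b \<le> j then connect f (Suc j) * ennreal (1 / Suc j) else 0)"
      by (simp add: connect_def)
  qed
  finally show ?thesis .
qed

definition below :: "(nat \<Rightarrow> ennreal) \<Rightarrow> nat \<Rightarrow> ennreal" where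
  "below f n = (\<Sum>j. if Suc j < n then f (Suc j) else 0)"

text \<open>The second letter: the sum over \<open>n\<close> above a given variable is absorbed by the connector and leaves
  a factor \<open>1 / l\<close>.\<close>

lemma connect_below:
  "connect (\<lambda>n. below f n * ennreal (1 / n)) (Suc l) = connect f (Suc l) * ennreal (1 / Suc l)"
proof -
  have "connect (\<lambda>n. below f n * ennreal (1 / n)) (Suc l) =
        (\<Sum>i. below f (Suc i) * ennreal (connector (Suc l) (Suc i) / Suc i))"
    unfolding connect_def
    by (intro suminf_cong)
       (simp add: mult.assoc ennreal_mult'[symmetric] less_imp_le[OF connector_pos]
          connector_commute[of "Suc l"])
  also have "\<dots> = (\<Sum>i. \<Sum>j. f (Suc j) *
      (if Suc j \<le> i then ennreal (connector (Suc l) (Suc i) / Suc i) else 0))"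
    unfolding below_def ennreal_suminf_multc[symmetric] by (intro suminf_cong) auto
  also have "\<dots> = (\<Sum>j. \<Sum>i. f (Suc j) *
      (if Suc j \<le> i then ennreal (connector (Suc l) (Suc i) / Suc i) else 0))"
    by (rule suminf_swap_ennreal)
  also have "\<dots> = (\<Sum>j. f (Suc j) * ennreal (connector (Suc l) (Suc j) / Suc l))"
    by (simp only: suminf_connector ennreal_suminf_cmult)
  also have "\<dots> = (\<Sum>j. f (Suc j) * ennreal (connector (Suc j) (Suc l)) * ennreal (1 / Suc l))"
    by (intro suminf_cong)
       (simp add: mult.assoc ennreal_mult'[symmetric] less_imp_le[OF connector_pos]
          connector_commute[of "Suc l"])
  finally show ?thesis by (simp add: connect_def)
qed

section \<open>Transport of nested sums to the dual index\<close>

text \<open>Multiple harmonic sums, with strict inequalities between the variables.\<close>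

fun mhs :: "nat list \<Rightarrow> nat \<Rightarrow> real" where
  "mhs [] n = 1"
| "mhs (k # ks) n = (\<Sum>i<n. mhs ks i / real (Suc i) ^ k)"

text \<open>The sum over \<open>n < n\<^sub>1 < n\<^sub>2 < \<cdots>\<close>, with the exponents listed from the smallest variable upwards.\<close>

fun tail :: "nat list \<Rightarrow> nat \<Rightarrow> ennreal" where
  "tail [] n = 1"
| "tail (k # ks) n = (\<Sum>i. if n \<le> i then tail ks (Suc i) * ennreal (1 / real (Suc i) ^ k) else 0)"

text \<open>The sum over \<open>l\<^sub>1 > l\<^sub>2 > \<cdots>\<close>, with a weight on the largest variable and the exponents listed
  from the largest variable downwards. It is meant for nonempty lists.\<close>

definition down_sum :: "(nat \<Rightarrow> ennreal) \<Rightarrow> nat list \<Rightarrow> ennreal" where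
  "down_sum h ls = (\<Sum>j. h (Suc j) * ennreal (mhs (tl ls) j / real (Suc j) ^ hd ls))"

lemma mhs_nonneg: "mhs ks n \<ge> 0"
  by (induction ks arbitrary: n) (auto intro!: sum_nonneg)

lemma down_sum_Suc:
  "down_sum h (Suc l # ls) = down_sum (\<lambda>n. h n * ennreal (1 / n)) (l # ls)"
  unfolding down_sum_def
  by (intro suminf_cong) (simp add: mult.assoc ennreal_mult'[symmetric] mhs_nonneg)

text \<open>A head 1 carries a complete variable, and summing it out turns the weight into its sum over larger
  arguments, in the form produced by \<open>connect_divide\<close>.\<close>

lemma down_sum_one:
  assumes "ls \<noteq> []"
  shows "down_sum h (1 # ls) = down_sum (\<lambda>n. \<Sum>j. if n \<le> j then h (Suc j) * ennreal (1 / Suc j) else 0) ls"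
proof -
  obtain l ls' where ls: "ls = l # ls'" using assms by (cases ls) auto
  let ?z = "\<lambda>i. ennreal (mhs ls' i / real (Suc i) ^ l)"
  have mhs: "ennreal (mhs ls j) = (\<Sum>i. if Suc i \<le> j then ?z i else 0)" for j
  proof -
    have "ennreal (mhs ls j) = (\<Sum>i<j. ?z i)"
      by (simp add: ls sum_ennreal mhs_nonneg)
    also have "\<dots> = (\<Sum>i. if Suc i \<le> j then ?z i else 0)"
      by (subst suminf_finite[of "{..<j}"]) (auto intro!: sum.cong)
    finally show ?thesis .
  qed
  have "down_sum h (1 # ls) = (\<Sum>j. h (Suc j) * ennreal (1 / Suc j) * ennreal (mhs ls j))"
    unfolding down_sum_def
    by (intro suminf_cong) (simp add: mult.assoc ennreal_mult'[symmetric] mhs_nonneg)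
  also have "\<dots> = (\<Sum>j. \<Sum>i. h (Suc j) * ennreal (1 / Suc j) * (if Suc i \<le> j then ?z i else 0))"
    by (simp only: mhs ennreal_suminf_cmult)
  also have "\<dots> = (\<Sum>i. \<Sum>j. h (Suc j) * ennreal (1 / Suc j) * (if Suc i \<le> j then ?z i else 0))"
    by (rule suminf_swap_ennreal)
  also have "\<dots> = (\<Sum>i. \<Sum>j. (if Suc i \<le> j then h (Suc j) * ennreal (1 / Suc j) else 0) * ?z i)"
    by (intro suminf_cong) auto
  also have "\<dots> = down_sum (\<lambda>n. \<Sum>j. if n \<le> j then h (Suc j) * ennreal (1 / Suc j) else 0) ls"
    by (simp only: down_sum_def ennreal_suminf_multc ls list.sel)
  finally show ?thesis .
qed

text \<open>The word of an admissible index ends in a factor \<open>1 / n\<close> that the starting value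
  \<open>connector n 0 = 1\<close> converts into the outermost dual sum. It is not part of the duality, hence the
  last exponent drops by 1. A part of a composition stands for one letter less than its size, so a
  leading block \<open>1 / n\<^sup>k\<close> is the head \<open>Suc k\<close>.\<close>

definition decr_last :: "nat list \<Rightarrow> nat list" where
  "decr_last ks = butlast ks @ [last ks - 1]"

lemma down_sum_cong:
  assumes "\<And>l. h (Suc l) = h' (Suc l)"
  shows "down_sum h ls = down_sum h' ls"
  using assms by (simp add: down_sum_def)

lemma composition_decr_last:
  assumes "composition ms" "last (Suc k # ms) \<ge> 2"
  shows "composition (decr_last (Suc k # ms))"
  using assms in_set_butlastD[of _ "Suc k # ms"] by (force simp: decr_last_def composition_def)

lemma decr_last_Cons: "ms \<noteq> [] \<Longrightarrow> decr_last (m # ms) = m # decr_last ms"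
  by (simp add: decr_last_def)

lemma connected_sum_transport_Suc:
  assumes "composition ms" "last (Suc k # ms) \<ge> 2"
    and IH: "\<And>f. (\<Sum>i. f (Suc i) * ennreal (1 / real (Suc i) ^ k) * tail ms (Suc i)) =
         down_sum (connect f) (hoffman_dual (decr_last (Suc k # ms)))"
  shows "(\<Sum>i. f (Suc i) * ennreal (1 / real (Suc i) ^ Suc k) * tail ms (Suc i)) =
         down_sum (connect f) (hoffman_dual (decr_last (Suc (Suc k) # ms)))"
proof -
  obtain j js where j: "decr_last (Suc k # ms) = j # js" "decr_last (Suc (Suc k) # ms) = Suc j # js"
    using assms(2) by (cases "ms = []") (auto simp: decr_last_Cons, auto simp: decr_last_def)
  have comp: "composition (j # js)"
    using composition_decr_last[OF assms(1,2)] j by simp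
  have "(\<Sum>i. f (Suc i) * ennreal (1 / real (Suc i) ^ Suc k) * tail ms (Suc i)) =
        (\<Sum>i. f (Suc i) * ennreal (1 / Suc i) * ennreal (1 / real (Suc i) ^ k) * tail ms (Suc i))"
    by (intro suminf_cong) (simp add: mult.assoc ennreal_mult'[symmetric])
  also have "\<dots> = down_sum (connect (\<lambda>n. f n * ennreal (1 / n))) (hoffman_dual (j # js))"
    using IH[of "\<lambda>n. f n * ennreal (1 / n)"] j by simp
  also have "\<dots> = down_sum (connect f) (1 # hoffman_dual (j # js))"
    by (subst down_sum_one) (use comp in \<open>simp_all add: hoffman_dual_not_Nil connect_divide[abs_def]\<close>)
  also have "1 # hoffman_dual (j # js) = hoffman_dual (decr_last (Suc (Suc k) # ms))"
    using comp j by (simp add: hoffman_dual_Suc composition_Cons)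
  finally show ?thesis .
qed

text \<open>The index is consumed from the smallest variable outwards, which changes only the weight \<open>f\<close>. An
  exponent \<open>k > 0\<close> releases a factor \<open>1 / n\<close> (\<open>connect_divide\<close>, a new head 1 of the dual); at \<open>k = 0\<close>
  the variable itself is summed out into the next one (\<open>connect_below\<close>, the head of the dual
  increases).\<close>

lemma connected_sum_transport:
  assumes "composition ms" "last (Suc k # ms) \<ge> 2"
  shows "(\<Sum>i. f (Suc i) * ennreal (1 / real (Suc i) ^ k) * tail ms (Suc i)) =
         down_sum (connect f) (hoffman_dual (decr_last (Suc k # ms)))"
  using assms
proof (induction ms arbitrary: k f)
  case Nil
  then have "k \<ge> 1" by simp
  then show ?case
  proof (induction k arbitrary: f rule: nat_induct_at_least)
    case base
    have "(\<Sum>i. f (Suc i) * ennreal (1 / real (Suc i) ^ 1) * tail [] (Suc i)) =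
          connect (\<lambda>n. f n * ennreal (1 / n)) 0"
      by (simp add: connect_def connector_0)
    also have "\<dots> = down_sum (connect f) [1]"
      by (simp add: connect_divide down_sum_def)
    finally show ?case
      by (simp add: decr_last_def hoffman_dual_one[simplified])
  next
    case (Suc k)
    then show ?case by (intro connected_sum_transport_Suc) (auto simp: composition_def)
  qed
next
  case (Cons m ms)
  have "last (m # ms) \<ge> 2" "m \<ge> 1" "composition ms"
    using Cons.prems by (auto simp: composition_Cons)
  then obtain m' where m: "m = Suc m'" by (cases m) auto
  show ?case
  proof (induction k arbitrary: f)
    case 0
    let ?g = "\<lambda>n. below f n * ennreal (1 / n)"
    have "(\<Sum>i. f (Suc i) * ennreal (1 / real (Suc i) ^ 0) * tail (m # ms) (Suc i)) =
          (\<Sum>i. \<Sum>j. f (Suc i) *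
             (if Suc i \<le> j then tail ms (Suc j) * ennreal (1 / real (Suc j) ^ m) else 0))"
      by (simp add: ennreal_suminf_cmult)
    also have "\<dots> = (\<Sum>j. \<Sum>i. f (Suc i) *
             (if Suc i \<le> j then tail ms (Suc j) * ennreal (1 / real (Suc j) ^ m) else 0))"
      by (rule suminf_swap_ennreal)
    also have "\<dots> = (\<Sum>j. below f (Suc j) * (tail ms (Suc j) * ennreal (1 / real (Suc j) ^ m)))"
      unfolding below_def ennreal_suminf_multc[symmetric] by (intro suminf_cong) auto
    also have "\<dots> = (\<Sum>j. ?g (Suc j) * ennreal (1 / real (Suc j) ^ m') * tail ms (Suc j))"
      by (intro suminf_cong) (simp add: m ac_simps ennreal_mult'[symmetric])
    also have "\<dots> = down_sum (connect ?g) (hoffman_dual (decr_last (m # ms)))"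
      using Cons.IH[of m' ?g] \<open>last (m # ms) \<ge> 2\<close> \<open>composition ms\<close> by (simp only: m)
    also have "\<dots> = down_sum (\<lambda>n. connect f n * ennreal (1 / n)) (hoffman_dual (decr_last (m # ms)))"
      by (rule down_sum_cong) (rule connect_below)
    also have "\<dots> = down_sum (connect f) (hoffman_dual (decr_last (Suc 0 # m # ms)))"
    proof -
      have comp: "composition (decr_last (m # ms))"
        using composition_decr_last[of ms m'] \<open>last (m # ms) \<ge> 2\<close> \<open>composition ms\<close> m by simp
      obtain j js where j: "decr_last (m # ms) = j # js"
        by (cases "decr_last (m # ms)") (auto simp: decr_last_def)
      obtain l ls where l: "hoffman_dual (j # js) = l # ls"
        using comp j hoffman_dual_not_Nil[of "j # js"] by (cases "hoffman_dual (j # js)") auto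
      show ?thesis
        using comp j l hoffman_dual_Cons_one[of j js l ls]
        by (simp add: decr_last_Cons down_sum_Suc)
    qed
    finally show ?case .
  next
    case (Suc k)
    then show ?case using Cons.prems by (intro connected_sum_transport_Suc) auto
  qed
qed

section \<open>The transform of the central binomial weights\<close>

definition central :: "nat \<Rightarrow> real" where
  "central n = real ((2 * n) choose n) / 4 ^ n"

lemma central_nonneg: "central n \<ge> 0"
  by (simp add: central_def)

lemma central_0: "central 0 = 1"
  by (simp add: central_def)

lemma central_Suc: "central (Suc n) = central n * real (2 * n + 1) / real (2 * n + 2)"
proof -
  have b: "real (2 * m choose m) = fact (2 * m) / (fact m * fact m)" for m
    using binomial_fact[of m "2 * m", where 'a = real] by (simp add: mult_2)
  show ?thesis
    unfolding central_def b by (simp add: divide_simps) (simp add: algebra_simps)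
qed

text \<open>Wallis: \<open>(2n + 1)(2n + 3) \<le> (2n + 2)\<^sup>2\<close> makes the left-hand side decreasing.\<close>

lemma central_square_le: "(central n)\<^sup>2 * real (2 * n + 1) \<le> 1"
proof (induction n)
  case 0
  show ?case by (simp add: central_0)
next
  case (Suc n)
  have "real (2 * n + 1) * real (2 * n + 3) \<le> (real (2 * n + 2))\<^sup>2"
    by (simp add: power2_eq_square algebra_simps)
  then have q: "real (2 * n + 1) * real (2 * n + 3) / (real (2 * n + 2))\<^sup>2 \<le> 1"
    by (simp add: divide_le_eq)
  have "(central (Suc n))\<^sup>2 * real (2 * Suc n + 1) =
        ((central n)\<^sup>2 * real (2 * n + 1)) * (real (2 * n + 1) * real (2 * n + 3) / (real (2 * n + 2))\<^sup>2)"
    by (simp add: central_Suc power2_eq_square mult_ac add_ac)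
  also have "\<dots> \<le> 1 * 1"
    by (rule mult_mono) (use Suc q in auto)
  finally show ?case by simp
qed

lemma central_le: "central n \<le> 1 / sqrt (real (Suc n))"
proof -
  have "(central n)\<^sup>2 * real (Suc n) \<le> (central n)\<^sup>2 * real (2 * n + 1)"
    by (rule mult_left_mono) auto
  then have "(central n)\<^sup>2 * real (Suc n) \<le> 1"
    using central_square_le[of n] by linarith
  then have "sqrt ((central n)\<^sup>2 * real (Suc n)) \<le> 1" by simp
  then have "central n * sqrt (real (Suc n)) \<le> 1"
    by (simp only: real_sqrt_mult real_sqrt_abs abs_of_nonneg[OF central_nonneg])
  then show ?thesis by (simp add: field_simps)
qed

lemma powr_Suc_tendsto_0: "s < 0 \<Longrightarrow> (\<lambda>n. real (Suc n) powr s) \<longlonglongrightarrow> 0"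
  by (rule tendsto_neg_powr[OF _ filterlim_compose[OF filterlim_real_sequentially filterlim_Suc]])

lemma central_tendsto_0: "central \<longlonglongrightarrow> 0"
proof (rule tendsto_sandwich[OF _ _ tendsto_const])
  show "(\<lambda>n. 1 / sqrt (real (Suc n))) \<longlonglongrightarrow> 0"
    using powr_Suc_tendsto_0[of "- 1 / 2"]
    by (simp add: powr_minus_divide powr_half_sqrt del: of_nat_Suc)
  show "\<forall>\<^sub>F n in sequentially. central n \<le> 1 / sqrt (real (Suc n))"
    by (intro always_eventually allI central_le)
qed (simp add: central_nonneg)

text \<open>The terms \<open>c i\<close> are hypergeometric, and Gosper's algorithm finds the antidifference \<open>F i\<close>, a
  rational multiple of \<open>c i\<close>. Its limit is 0 because one factor of the connector can be
  traded for the linear numerator, leaving at most a multiple of the central weights.\<close>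

lemma connect_central:
  "connect (\<lambda>n. ennreal (central n)) (Suc l) = ennreal (1 / real (2 * l + 1))"
proof -
  define c where "c i = central (Suc i) * connector (Suc i) (Suc l)" for i
  define F where "F i = 2 * real (Suc i + Suc l) / real (2 * l + 1) * c i" for i
  have c_Suc: "c (Suc i) * real (2 * (Suc i + Suc l) + 2) = c i * real (2 * i + 3)" for i
    unfolding c_def central_Suc[of "Suc i"] connector_commute[of _ "Suc l"] connector_Suc[of _ "Suc i"]
    by (simp add: divide_simps) (simp add: algebra_simps)
  have F_mult: "F i * real (2 * l + 1) = 2 * real (Suc i + Suc l) * c i" for i
    unfolding F_def by (simp del: of_nat_Suc of_nat_add)
  have F_diff: "c i = F i - F (Suc i)" for i
  proof -
    have "(F i - F (Suc i)) * real (2 * l + 1) =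
          2 * real (Suc i + Suc l) * c i - c (Suc i) * real (2 * (Suc i + Suc l) + 2)"
      unfolding left_diff_distrib F_mult by simp
    also have "\<dots> = c i * real (2 * l + 1)"
      unfolding c_Suc by (simp add: algebra_simps)
    finally show ?thesis by simp
  qed
  \<comment> \<open>Trading \<open>Suc i + Suc l\<close> for a connector of smaller second argument.\<close>
  have F_eq: "F i = 2 * real (Suc l) / real (2 * l + 1) * central (Suc i) * connector (Suc i) l" for i
    unfolding F_def c_def connector_Suc
    by (simp add: divide_simps) (simp add: algebra_simps)
  have "F \<longlonglongrightarrow> 0"
  proof (rule tendsto_sandwich[OF _ _ tendsto_const])
    show "(\<lambda>i. 2 * real (Suc l) / real (2 * l + 1) * central (Suc i)) \<longlonglongrightarrow> 0"
      using LIMSEQ_Suc[OF central_tendsto_0] by (rule tendsto_mult_right_zero)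
    have "connector (Suc i) l \<le> 1" for i
      using connector_le[of "Suc i" l] by (rule order_trans) simp_all
    then show "\<forall>\<^sub>F i in sequentially. F i \<le> 2 * real (Suc l) / real (2 * l + 1) * central (Suc i)"
      unfolding F_eq
      by (intro always_eventually allI mult_left_le) (auto simp: central_nonneg)
    show "\<forall>\<^sub>F i in sequentially. 0 \<le> F i"
      by (simp add: F_eq central_nonneg less_imp_le[OF connector_pos])
  qed
  then have "(\<Sum>i. if 0 \<le> i then ennreal (c i) else 0) = ennreal (F 0)"
    by (rule suminf_telescope_from)
       (simp_all add: F_diff[symmetric], simp add: c_def central_nonneg less_imp_le[OF connector_pos])
  moreover have "F 0 = 1 / real (2 * l + 1)"
    by (simp add: F_def c_def central_Suc central_0 connector_def divide_simps)
  ultimately show ?thesis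
    by (simp add: connect_def c_def ennreal_mult'[symmetric] central_nonneg)
qed

section \<open>Sums over ordered tuples\<close>

definition ordered_tuples :: "(nat \<Rightarrow> nat \<Rightarrow> bool) \<Rightarrow> nat set \<Rightarrow> nat \<Rightarrow> nat list set" where
  "ordered_tuples R A r = {ns. length ns = r \<and> sorted_wrt R ns \<and> set ns \<subseteq> A}"

lemma ordered_tuples_0: "ordered_tuples R A 0 = {[]}"
  by (auto simp: ordered_tuples_def)

text \<open>The head of a tuple ordered by \<open>R\<close> restricts all later entries to its \<open>R\<close>-successors. The recursions
  for star sums, truncated polylogarithms and zeta tails are instances.\<close>

lemma ordered_tuples_Suc:
  "ordered_tuples R A (Suc r) = (\<lambda>(n, ns). n # ns) ` (SIGMA n:A. ordered_tuples R {m\<in>A. R n m} r)"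
  by (fastforce simp: ordered_tuples_def length_Suc_conv image_iff)

lemma inj_on_Cons_pair: "inj_on (\<lambda>(n, ns). n # ns) S"
  by (auto simp: inj_on_def)

lemma finite_ordered_tuples: "finite A \<Longrightarrow> finite (ordered_tuples R A r)"
  by (rule finite_subset[OF _ finite_lists_length_eq[of A r]]) (auto simp: ordered_tuples_def)

lemma sum_ordered_tuples_Suc:
  fixes g :: "nat list \<Rightarrow> 'a :: comm_monoid_add"
  assumes "finite A"
  shows "sum g (ordered_tuples R A (Suc r)) = (\<Sum>n\<in>A. \<Sum>ns\<in>ordered_tuples R {m\<in>A. R n m} r. g (n # ns))"
proof -
  have "sum g (ordered_tuples R A (Suc r)) =
        (\<Sum>(n, ns)\<in>(SIGMA n:A. ordered_tuples R {m\<in>A. R n m} r). g (n # ns))"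
    unfolding ordered_tuples_Suc by (subst sum.reindex[OF inj_on_Cons_pair]) (simp add: case_prod_unfold)
  also have "\<dots> = (\<Sum>n\<in>A. \<Sum>ns\<in>ordered_tuples R {m\<in>A. R n m} r. g (n # ns))"
    by (rule sum.Sigma[symmetric]) (use assms in \<open>auto intro: finite_ordered_tuples\<close>)
  finally show ?thesis .
qed

lemma sum_atLeast1: "(\<Sum>n\<in>{1..M}. g n) = (\<Sum>i<M. g (Suc i))"
  by (simp add: sum.atLeast1_atMost_eq)

lemma zeta_star_altdef:
  "zeta_star n ks = (\<Sum>ns\<in>ordered_tuples (\<ge>) {1..n} (length ks). \<Prod>i<length ks. 1 / real (ns ! i) ^ (ks ! i))"
  by (simp add: zeta_star_def ordered_tuples_def)

lemma zeta_star_Nil: "zeta_star n [] = 1"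
  by (simp add: zeta_star_altdef ordered_tuples_0)

lemma zeta_star_Cons:
  "zeta_star n (k # ks) = (\<Sum>i<n. zeta_star (Suc i) ks / real (Suc i) ^ k)"
proof -
  have set: "{m \<in> {1..n}. m \<le> Suc i} = {1..Suc i}" if "i < n" for i
    using that by auto
  have "zeta_star n (k # ks) = (\<Sum>i<n. \<Sum>ns\<in>ordered_tuples (\<ge>) {m \<in> {1..n}. m \<le> Suc i} (length ks).
      \<Prod>j<length (k # ks). 1 / real ((Suc i # ns) ! j) ^ ((k # ks) ! j))"
    by (simp only: zeta_star_altdef list.size(4) add_Suc_right add_0_right sum_ordered_tuples_Suc
          finite_atLeastAtMost sum_atLeast1)
  also have "\<dots> = (\<Sum>i<n. \<Sum>ns\<in>ordered_tuples (\<ge>) {1..Suc i} (length ks).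
      \<Prod>j<length (k # ks). 1 / real ((Suc i # ns) ! j) ^ ((k # ks) ! j))"
    by (intro sum.cong) (simp_all only: set lessThan_iff)
  finally show ?thesis
    by (simp add: zeta_star_altdef prod.lessThan_Suc_shift sum_divide_distrib
          del: prod.lessThan_Suc of_nat_Suc)
qed

lemma zeta_star_nonneg: "zeta_star n ks \<ge> 0"
  by (auto simp: zeta_star_def intro!: sum_nonneg prod_nonneg)

lemma Li_trunc_altdef:
  "Li_trunc M ks zs = (\<Sum>ns\<in>ordered_tuples (>) {1..M} (length ks).
     \<Prod>i<length ks. (zs ! i) ^ (ns ! i) / of_nat (ns ! i) ^ (ks ! i))"
  by (simp add: Li_trunc_def ordered_tuples_def)

lemma Li_trunc_Nil: "Li_trunc M [] zs = 1"
  by (simp add: Li_trunc_altdef ordered_tuples_0)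

lemma Li_trunc_Cons:
  "Li_trunc M (k # ks) (z # zs) =
     (\<Sum>i<M. z ^ Suc i / of_nat (Suc i) ^ k * Li_trunc i ks zs)"
proof -
  have set: "{m \<in> {1..M}. m < Suc i} = {1..i}" if "i < M" for i
    using that by auto
  have "Li_trunc M (k # ks) (z # zs) =
      (\<Sum>i<M. \<Sum>ns\<in>ordered_tuples (>) {m \<in> {1..M}. m < Suc i} (length ks).
      \<Prod>j<length (k # ks). ((z # zs) ! j) ^ ((Suc i # ns) ! j) / of_nat ((Suc i # ns) ! j) ^ ((k # ks) ! j))"
    by (simp only: Li_trunc_altdef list.size(4) add_Suc_right add_0_right sum_ordered_tuples_Suc
          finite_atLeastAtMost sum_atLeast1)
  also have "\<dots> = (\<Sum>i<M. \<Sum>ns\<in>ordered_tuples (>) {1..i} (length ks).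
      \<Prod>j<length (k # ks). ((z # zs) ! j) ^ ((Suc i # ns) ! j) / of_nat ((Suc i # ns) ! j) ^ ((k # ks) ! j))"
    by (intro sum.cong) (simp_all only: set lessThan_iff)
  finally show ?thesis
    by (simp add: Li_trunc_altdef prod.lessThan_Suc_shift sum_distrib_left
          del: prod.lessThan_Suc of_nat_Suc power_Suc)
qed

section \<open>Growth and convergence\<close>

lemma sum_powr_le: "(\<Sum>i<n. real (Suc i) powr (- 3 / 4)) \<le> 4 * real n powr (1 / 4)"
proof (induction n)
  case (Suc n)
  define x y where "x = real (Suc n) powr (1 / 4)" and "y = real n powr (1 / 4)"
  have x: "x ^ 4 = real (Suc n)" and y: "y ^ 4 = real n"
    by (cases "n = 0"; simp add: x_def y_def powr_power del: of_nat_Suc)+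
  have pos: "x > 0" "y \<ge> 0" by (simp_all add: x_def y_def)
  have "y \<le> x" unfolding x_def y_def by (rule powr_mono2) auto
  have "1 = (x - y) * (x ^ 3 + x\<^sup>2 * y + x * y\<^sup>2 + y ^ 3)"
    using x y by (simp add: algebra_simps power2_eq_square power3_eq_cube power4_eq_xxxx)
  also have "\<dots> \<le> (x - y) * (4 * x ^ 3)"
  proof (rule mult_left_mono)
    have "x\<^sup>2 * y \<le> x\<^sup>2 * x" "x * y\<^sup>2 \<le> x * x\<^sup>2" "y ^ 3 \<le> x ^ 3"
      using \<open>y \<le> x\<close> pos by (auto intro!: mult_left_mono power_mono)
    then show "x ^ 3 + x\<^sup>2 * y + x * y\<^sup>2 + y ^ 3 \<le> 4 * x ^ 3"
      by (simp add: power2_eq_square power3_eq_cube)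
  qed (use \<open>y \<le> x\<close> in simp)
  finally have "1 \<le> (4 * x - 4 * y) * x ^ 3" by (simp add: algebra_simps)
  then have "1 / x ^ 3 \<le> 4 * x - 4 * y"
    using pos by (simp add: divide_le_eq)
  moreover have "1 / x ^ 3 = real (Suc n) powr (- 3 / 4)"
    by (simp add: x_def powr_power powr_minus_divide del: of_nat_Suc)
  ultimately show ?case using Suc.IH by (simp add: x_def y_def)
qed auto

lemma summable_powr_Suc: "s < - 1 \<Longrightarrow> summable (\<lambda>n. real (Suc n) powr s)"
  by (subst summable_Suc_iff[of "\<lambda>n. real n powr s"]) (simp add: summable_real_powr_iff)

text \<open>The exponent \<open>1/4\<close> reproduces itself under summation against \<open>1 / n\<close>, so that one bound covers nested
  sums of every depth in place of powers of the logarithm. Any exponent in \<open>(0, 1/2)\<close> would make the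
  binomial series converge, whose weights are of order \<open>n^(-1/2)\<close>.\<close>

lemma norm_sum_le_powr:
  fixes w :: "nat \<Rightarrow> 'a :: real_normed_vector"
  assumes "\<And>i. i < n \<Longrightarrow> norm (w i) \<le> C * real (Suc i) powr (1 / 4) / real (Suc i)"
  shows "norm (\<Sum>i<n. w i) \<le> 4 * C * real n powr (1 / 4)"
proof (cases "n = 0")
  case False
  have "0 \<le> C * real (Suc 0) powr (1 / 4) / real (Suc 0)"
    using assms[of 0] False norm_ge_zero order_trans by blast
  then have "C \<ge> 0" by simp
  have "norm (\<Sum>i<n. w i) \<le> (\<Sum>i<n. C * real (Suc i) powr (- 3 / 4))"
  proof (rule sum_norm_le)
    fix i assume "i \<in> {..<n}"
    moreover have "real (Suc i) powr (1 / 4) / real (Suc i) = real (Suc i) powr (- 3 / 4)"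
      using powr_diff[of "real (Suc i)" "1 / 4" 1] by (simp add: powr_one)
    ultimately show "norm (w i) \<le> C * real (Suc i) powr (- 3 / 4)"
      using assms[of i] by (simp only: lessThan_iff times_divide_eq_right[symmetric])
  qed
  also have "\<dots> \<le> C * (4 * real n powr (1 / 4))"
    unfolding sum_distrib_left[symmetric] by (rule mult_left_mono[OF sum_powr_le \<open>C \<ge> 0\<close>])
  finally show ?thesis by (simp add: mult_ac)
qed auto

lemma inverse_power_le:
  assumes "k \<ge> 1"
  shows "1 / real (Suc i) ^ k \<le> 1 / real (Suc i)"
  using assms power_increasing[of 1 k "real (Suc i)"]
  by (intro divide_left_mono) (simp_all del: of_nat_Suc)

lemma zeta_star_le:
  assumes "composition ks"
  shows "\<exists>C\<ge>0. \<forall>n. zeta_star (Suc n) ks \<le> C * real (Suc n) powr (1 / 4)"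
  using assms
proof (induction ks)
  case Nil
  have "zeta_star (Suc n) [] \<le> 1 * real (Suc n) powr (1 / 4)" for n
    by (simp add: zeta_star_Nil ge_one_powr_ge_zero)
  then show ?case by (intro exI[of _ 1]) simp
next
  case (Cons k ks)
  then obtain C where C: "C \<ge> 0" "zeta_star (Suc n) ks \<le> C * real (Suc n) powr (1 / 4)" for n
    by (auto simp: composition_Cons)
  have "zeta_star (Suc n) (k # ks) \<le> 4 * C * real (Suc n) powr (1 / 4)" for n
  proof -
    have "norm (\<Sum>i<Suc n. zeta_star (Suc i) ks / real (Suc i) ^ k) \<le> 4 * C * real (Suc n) powr (1 / 4)"
    proof (rule norm_sum_le_powr)
      fix i
      have "norm (zeta_star (Suc i) ks / real (Suc i) ^ k) =
            zeta_star (Suc i) ks * (1 / real (Suc i) ^ k)"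
        using zeta_star_nonneg[of "Suc i" ks] by (simp add: norm_divide norm_power abs_of_nonneg)
      also have "\<dots> \<le> (C * real (Suc i) powr (1 / 4)) * (1 / real (Suc i))"
        using C Cons.prems
        by (intro mult_mono inverse_power_le) (auto simp: composition_Cons)
      finally show "norm (zeta_star (Suc i) ks / real (Suc i) ^ k) \<le>
        C * real (Suc i) powr (1 / 4) / real (Suc i)" by simp
    qed
    then show ?thesis unfolding zeta_star_Cons by simp
  qed
  then show ?case using C(1) by (intro exI[of _ "4 * C"]) simp
qed

lemma summable_binom_series:
  assumes "k \<ge> 1" "composition ks"
  shows "summable (\<lambda>i. central (Suc i) / real (Suc i) ^ k * zeta_star (Suc i) ks)"
proof -
  obtain C where C: "C \<ge> 0" "\<And>n. zeta_star (Suc n) ks \<le> C * real (Suc n) powr (1 / 4)"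
    using zeta_star_le[OF assms(2)] by blast
  have "summable (\<lambda>i. C * real (Suc i) powr (- 5 / 4))"
    by (intro summable_mult) (rule summable_powr_Suc, simp)
  then show ?thesis
  proof (rule summable_comparison_test')
    fix i :: nat
    have c: "central (Suc i) \<le> real (Suc i) powr (- 1 / 2)"
    proof -
      have "central (Suc i) \<le> 1 / sqrt (real (Suc (Suc i)))" by (rule central_le)
      also have "\<dots> \<le> 1 / sqrt (real (Suc i))" by (intro divide_left_mono) auto
      also have "\<dots> = real (Suc i) powr (- 1 / 2)"
        by (simp add: powr_minus_divide powr_half_sqrt del: of_nat_Suc)
      finally show ?thesis .
    qed
    have "norm (central (Suc i) / real (Suc i) ^ k * zeta_star (Suc i) ks) =
          central (Suc i) * (1 / real (Suc i) ^ k) * zeta_star (Suc i) ks"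
      using zeta_star_nonneg[of "Suc i" ks] central_nonneg[of "Suc i"]
      by (simp add: norm_mult norm_divide norm_power abs_of_nonneg)
    also have "\<dots> \<le> real (Suc i) powr (- 1 / 2) * (1 / real (Suc i)) * (C * real (Suc i) powr (1 / 4))"
      using c C assms zeta_star_nonneg central_nonneg
      by (intro mult_mono inverse_power_le) auto
    also have "1 / real (Suc i) = real (Suc i) powr (- 1)"
      by (simp add: powr_minus_divide del: of_nat_Suc)
    also have "real (Suc i) powr (- 1 / 2) * real (Suc i) powr (- 1) * (C * real (Suc i) powr (1 / 4)) =
        C * (real (Suc i) powr (- 1 / 2) * real (Suc i) powr (- 1) * real (Suc i) powr (1 / 4))"
      by (simp only: mult_ac)
    also have "\<dots> = C * real (Suc i) powr (- 5 / 4)"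
      by (simp only: powr_add[symmetric]) simp
    finally show "norm (central (Suc i) / real (Suc i) ^ k * zeta_star (Suc i) ks) \<le>
      C * real (Suc i) powr (- 5 / 4)" .
  qed
qed

lemma norm_Li_trunc_le:
  assumes "composition ks" "length zs = length ks" "\<forall>z\<in>set zs. norm z = 1"
  shows "\<exists>C\<ge>0. \<forall>n. norm (Li_trunc n ks zs) \<le> C * real (Suc n) powr (1 / 4)"
  using assms
proof (induction ks arbitrary: zs)
  case Nil
  have "norm (Li_trunc n [] zs) \<le> 1 * real (Suc n) powr (1 / 4)" for n
    by (simp add: Li_trunc_Nil ge_one_powr_ge_zero)
  then show ?case by (intro exI[of _ 1]) simp
next
  case (Cons k ks)
  then obtain z zs' where zs: "zs = z # zs'" by (cases zs) auto
  with Cons obtain C where C: "C \<ge> 0" "norm (Li_trunc n ks zs') \<le> C * real (Suc n) powr (1 / 4)" for n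
    by (metis composition_Cons length_Cons list.set_intros(2) nat.inject)
  have "norm (Li_trunc n (k # ks) zs) \<le> 4 * C * real (Suc n) powr (1 / 4)" for n
  proof -
    have "norm (Li_trunc n (k # ks) zs) \<le> 4 * C * real n powr (1 / 4)"
      unfolding zs Li_trunc_Cons
    proof (rule norm_sum_le_powr)
      fix i
      have "norm (z ^ Suc i / of_nat (Suc i) ^ k * Li_trunc i ks zs') =
            norm (Li_trunc i ks zs') * (1 / real (Suc i) ^ k)"
        using Cons.prems zs by (simp add: norm_mult norm_divide norm_power del: power_Suc of_nat_Suc)
      also have "\<dots> \<le> (C * real (Suc i) powr (1 / 4)) * (1 / real (Suc i))"
        using C Cons.prems by (intro mult_mono inverse_power_le) (auto simp: composition_Cons)
      finally show "norm (z ^ Suc i / of_nat (Suc i) ^ k * Li_trunc i ks zs') \<le>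
        C * real (Suc i) powr (1 / 4) / real (Suc i)" by simp
    qed
    also have "\<dots> \<le> 4 * C * real (Suc n) powr (1 / 4)"
      using C(1) by (intro mult_left_mono powr_mono2) auto
    finally show ?thesis .
  qed
  then show ?case using C(1) by (intro exI[of _ "4 * C"]) simp
qed

text \<open>Summation by parts against \<open>(-1)\<^sup>n\<close>: bounded variation and a null limit replace monotonicity, which
  is not available for coloured sums.\<close>

lemma convergent_alternating_sum:
  fixes b :: "nat \<Rightarrow> complex"
  assumes "b \<longlonglongrightarrow> 0" "summable (\<lambda>n. norm (b (Suc n) - b n))"
  shows "convergent (\<lambda>M. \<Sum>n<M. (-1) ^ n * b n)"
proof -
  \<comment> \<open>Average the sum with its own shift by one position.\<close>
  have eq: "(\<Sum>n<M. (-1) ^ n * b n) =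
            1 / 2 * (b 0 - (-1) ^ M * b M - (\<Sum>n<M. (-1) ^ n * (b (Suc n) - b n)))" for M
    by (induction M) (simp_all add: field_simps)
  have "summable (\<lambda>n. (-1) ^ n * (b (Suc n) - b n))"
    by (rule summable_norm_cancel) (use assms(2) in \<open>simp add: norm_mult norm_power\<close>)
  then have 1: "convergent (\<lambda>M. \<Sum>n<M. (-1) ^ n * (b (Suc n) - b n))"
    by (simp add: summable_iff_convergent)
  have "(\<lambda>M. (-1) ^ M * b M) \<longlonglongrightarrow> 0"
    by (rule tendsto_norm_zero_cancel)
       (use tendsto_norm_zero[OF assms(1)] in \<open>simp add: norm_mult norm_power\<close>)
  then have 2: "convergent (\<lambda>M. (-1) ^ M * b M)" by (rule convergentI)
  show ?thesis unfolding eq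
    by (intro convergent_mult convergent_diff convergent_const 1 2)
qed

text \<open>The inner sums \<open>A n\<close> grow by at most a multiple of \<open>n^(1/4) / n\<close> per step and are at most of order
  \<open>n^(1/4)\<close>, so \<open>A n / (n + 1)\<close> has increments of order \<open>n^(-7/4)\<close>.\<close>

lemma convergent_Li_trunc:
  assumes "composition ks" "length zs = length ks" "\<forall>z\<in>set zs. norm z = 1"
  shows "convergent (\<lambda>M. Li_trunc M (1 # ks) (-1 # zs))"
proof -
  obtain C where C: "C \<ge> 0" "\<And>n. norm (Li_trunc n ks zs) \<le> C * real (Suc n) powr (1 / 4)"
    using norm_Li_trunc_le[OF assms] by blast
  obtain D where D: "D \<ge> 0" "\<And>n. norm (Li_trunc (Suc n) ks zs - Li_trunc n ks zs) \<le> D * real (Suc n) powr (1 / 4) / real (Suc n)"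
  proof (cases ks)
    case Nil
    then show ?thesis using that[of 0] by (simp add: Li_trunc_Nil)
  next
    case (Cons k ks')
    then obtain z zs' where zs: "zs = z # zs'" using assms by (cases zs) auto
    with assms Cons obtain D where D: "D \<ge> 0" "norm (Li_trunc n ks' zs') \<le> D * real (Suc n) powr (1 / 4)" for n
      using norm_Li_trunc_le[of ks' zs'] by (auto simp: composition_Cons)
    show ?thesis
    proof (rule that[OF D(1)])
      fix n
      have "norm (Li_trunc (Suc n) ks zs - Li_trunc n ks zs) = norm (Li_trunc n ks' zs') * (1 / real (Suc n) ^ k)"
        using assms zs Cons by (simp add: Li_trunc_Cons norm_mult norm_divide norm_power del: power_Suc of_nat_Suc)
      also have "\<dots> \<le> (D * real (Suc n) powr (1 / 4)) * (1 / real (Suc n))"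
        using D assms Cons by (intro mult_mono inverse_power_le) (auto simp: composition_Cons)
      finally show "norm (Li_trunc (Suc n) ks zs - Li_trunc n ks zs) \<le> D * real (Suc n) powr (1 / 4) / real (Suc n)"
        by simp
    qed
  qed
  define b where "b n = Li_trunc n ks zs / of_nat (Suc n)" for n
  have "b \<longlonglongrightarrow> 0"
  proof (rule Lim_null_comparison)
    show "\<forall>\<^sub>F n in sequentially. norm (b n) \<le> C * (real (Suc n) powr (1 / 4) / real (Suc n))"
      using C by (intro always_eventually allI) (simp add: b_def norm_divide divide_right_mono del: of_nat_Suc)
    show "(\<lambda>n. C * (real (Suc n) powr (1 / 4) / real (Suc n))) \<longlonglongrightarrow> 0"
    proof (rule tendsto_mult_right_zero)
      have "real (Suc n) powr (1 / 4) / real (Suc n) = real (Suc n) powr (- 3 / 4)" for n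
        using powr_diff[of "real (Suc n)" "1 / 4" 1] by simp
      then show "(\<lambda>n. real (Suc n) powr (1 / 4) / real (Suc n)) \<longlonglongrightarrow> 0"
        using powr_Suc_tendsto_0[of "- 3 / 4"] by (simp del: of_nat_Suc)
    qed
  qed
  moreover have "summable (\<lambda>n. norm (b (Suc n) - b n))"
  proof (rule summable_comparison_test')
    show "summable (\<lambda>i. (C + D) * real (Suc i) powr (- 7 / 4))"
      by (intro summable_mult) (rule summable_powr_Suc, simp)
    fix n :: nat
    let ?A = "\<lambda>n. Li_trunc n ks zs" and ?q = "real (Suc n) powr (1 / 4)"
    have "b (Suc n) - b n = (?A (Suc n) - ?A n) / of_nat (Suc (Suc n)) - ?A n / (of_nat (Suc n) * of_nat (Suc (Suc n)))"
    proof -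
      have "(of_nat (Suc n) :: complex) \<noteq> 0" "(of_nat (Suc (Suc n)) :: complex) \<noteq> 0"
        unfolding of_nat_eq_0_iff by simp_all
      moreover have "(of_nat (Suc (Suc n)) :: complex) = of_nat (Suc n) + 1" by simp
      ultimately show ?thesis unfolding b_def
        by (simp add: divide_simps del: of_nat_Suc) (simp add: algebra_simps)
    qed
    then have "norm (norm (b (Suc n) - b n)) \<le>
      norm (?A (Suc n) - ?A n) / real (Suc (Suc n)) + norm (?A n) / (real (Suc n) * real (Suc (Suc n)))"
      using norm_triangle_ineq4[of "(?A (Suc n) - ?A n) / of_nat (Suc (Suc n))" "?A n / (of_nat (Suc n) * of_nat (Suc (Suc n)))"]
      by (simp add: norm_divide norm_mult del: of_nat_Suc)
    also have "\<dots> \<le> (D * ?q / real (Suc n)) / real (Suc n) + (C * ?q) / (real (Suc n) * real (Suc n))"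
      using C D by (intro add_mono frac_le) (auto intro!: mult_nonneg_nonneg divide_nonneg_nonneg)
    also have "\<dots> = (C + D) * (?q * (1 / real (Suc n)) * (1 / real (Suc n)))"
      by (simp add: add_divide_distrib distrib_right del: of_nat_Suc)
    also have "?q * (1 / real (Suc n)) * (1 / real (Suc n)) = ?q * real (Suc n) powr (-1) * real (Suc n) powr (-1)"
      by (simp add: powr_minus_divide del: of_nat_Suc)
    also have "\<dots> = real (Suc n) powr (- 7 / 4)"
      by (simp only: powr_add[symmetric]) simp
    finally show "norm (norm (b (Suc n) - b n)) \<le> (C + D) * real (Suc n) powr (- 7 / 4)" .
  qed
  ultimately have "convergent (\<lambda>M. \<Sum>n<M. (-1) ^ n * b n)"
    by (rule convergent_alternating_sum)
  then have "convergent (\<lambda>M. - (\<Sum>n<M. (-1) ^ n * b n))"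
    by (rule convergent_minus_iff[THEN iffD1])
  also have "(\<lambda>M. - (\<Sum>n<M. (-1) ^ n * b n)) = (\<lambda>M. Li_trunc M (1 # ks) (-1 # zs))"
    by (simp add: Li_trunc_Cons b_def sum_negf[symmetric] fun_eq_iff)
  finally show ?thesis .
qed

section \<open>Summation over the signs\<close>

text \<open>The colours \<open>t \<sigma>\<^sub>1, \<sigma>\<^sub>1 \<sigma>\<^sub>2, \<sigma>\<^sub>2 \<sigma>\<^sub>3, \<dots>\<close>; a leading sign \<open>t\<close> makes the family recursive.\<close>

fun adjacent_products :: "complex \<Rightarrow> complex list \<Rightarrow> complex list" where
  "adjacent_products t [] = []"
| "adjacent_products t (s # ss) = t * s # adjacent_products s ss"

lemma length_adjacent_products [simp]: "length (adjacent_products t ss) = length ss"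
  by (induction t ss rule: adjacent_products.induct) auto

lemma set_adjacent_products:
  "t \<in> {1, -1} \<Longrightarrow> set ss \<subseteq> {1, -1} \<Longrightarrow> set (adjacent_products t ss) \<subseteq> {1, -1}"
  by (induction t ss rule: adjacent_products.induct) auto

lemma adjacent_products_map_upt:
  "a \<le> b \<Longrightarrow> adjacent_products t (map \<sigma> [a..<Suc b]) = t * \<sigma> a # map (\<lambda>i. \<sigma> i * \<sigma> (i + 1)) [a..<b]"
proof (induction "b - a" arbitrary: a t)
  case 0
  then show ?case by simp
next
  case (Suc d)
  then have "a < b" "d = b - Suc a" by auto
  with Suc.hyps(1)[of "Suc a" "\<sigma> a"] show ?case
    by (simp only: upt_conv_Cons[of a] less_SucI list.map adjacent_products.simps) simp
qed

lemma sum_odd_less: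
  fixes g :: "nat \<Rightarrow> 'a :: comm_monoid_add"
  shows "(\<Sum>i<M. if odd i then g i else 0) = (\<Sum>j<M div 2. g (2 * j + 1))"
proof (induction M)
  case (Suc M)
  show ?case
  proof (cases "odd M")
    case True
    then obtain m where "M = 2 * m + 1" by (elim oddE)
    then show ?thesis using Suc by simp
  next
    case False
    then obtain m where "M = 2 * m" by auto
    then show ?thesis using Suc by simp
  qed
qed auto

definition sign_lists :: "nat \<Rightarrow> complex list set" where
  "sign_lists r = {ss. set ss \<subseteq> {1, -1} \<and> length ss = r}"

lemma sum_sign_lists_Suc:
  "(\<Sum>ss\<in>sign_lists (Suc r). g ss) = (\<Sum>ss\<in>sign_lists r. g (1 # ss) + g (-1 # ss))"
proof -
  have "sum g (sign_lists (Suc r)) = (\<Sum>(ss, s)\<in>sign_lists r \<times> {1, -1}. g (s # ss))"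
    unfolding sign_lists_def lists_length_Suc_eq
    by (subst sum.reindex) (auto simp: inj_on_def case_prod_unfold)
  also have "\<dots> = (\<Sum>ss\<in>sign_lists r. \<Sum>s\<in>{1, -1}. g (s # ss))"
    by (rule sum.Sigma[symmetric]) (auto simp: sign_lists_def finite_lists_length_eq)
  finally show ?thesis by simp
qed

text \<open>The sign \<open>\<sigma>\<^sub>1\<close> enters through the power of \<open>t \<sigma>\<^sub>1\<close> at the largest variable and through the inner sum. The
  latter, once summed over the remaining signs, does not depend on \<open>\<sigma>\<^sub>1\<close> by induction, so summing over \<open>\<sigma>\<^sub>1\<close>
  keeps exactly the even values of the largest variable, with a factor 2. Halving all variables
  gives the power of 2 in the denominator.\<close>

lemma sum_signs_Li_trunc:
  assumes "t \<in> {1, -1}"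
  shows "(\<Sum>ss\<in>sign_lists (length ks). Li_trunc M ks (adjacent_products t ss)) =
         of_real (2 ^ length ks / 2 ^ sum_list ks * mhs ks (M div 2))"
  using assms
proof (induction ks arbitrary: M t)
  case Nil
  have "sign_lists 0 = {[]}" by (auto simp: sign_lists_def)
  then show ?case by (simp add: Li_trunc_Nil)
next
  case (Cons k ks)
  define c :: real where "c = 2 ^ length ks / 2 ^ sum_list ks"
  let ?L = "\<lambda>s i. \<Sum>ss\<in>sign_lists (length ks). Li_trunc i ks (adjacent_products s ss)"
  have IH: "?L s i = of_real (c * mhs ks (i div 2))" if "s \<in> {1, -1}" for s i
    using Cons.IH[OF that] by (simp add: c_def)
  have "(\<Sum>ss\<in>sign_lists (length (k # ks)). Li_trunc M (k # ks) (adjacent_products t ss)) =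
        (\<Sum>i<M. t ^ Suc i / of_nat (Suc i) ^ k * ?L 1 i + (- t) ^ Suc i / of_nat (Suc i) ^ k * ?L (-1) i)"
    unfolding list.size(4) add_Suc_right add_0_right sum_sign_lists_Suc adjacent_products.simps
      Li_trunc_Cons sum.distrib[symmetric] sum_distrib_left
    by (subst sum.swap) simp
  also have "\<dots> = (\<Sum>i<M. if odd i then of_real (2 * c * mhs ks (i div 2) / real (Suc i) ^ k) else 0)"
    using Cons.prems by (intro sum.cong) (auto simp: IH simp del: of_nat_Suc)
  also have "\<dots> = (\<Sum>j<M div 2. of_real (2 * c * mhs ks j / real (2 * Suc j) ^ k))"
    by (subst sum_odd_less) simp
  also have "\<dots> = of_real (\<Sum>j<M div 2. 2 * c / 2 ^ k * (mhs ks j / real (Suc j) ^ k))"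
  proof -
    have "real (2 * Suc j) ^ k = 2 ^ k * real (Suc j) ^ k" for j
      by (simp only: of_nat_mult power_mult_distrib of_nat_numeral)
    then show ?thesis by (simp only: of_real_sum) simp
  qed
  also have "(\<Sum>j<M div 2. 2 * c / 2 ^ k * (mhs ks j / real (Suc j) ^ k)) =
             2 ^ length (k # ks) / 2 ^ sum_list (k # ks) * mhs (k # ks) (M div 2)"
    unfolding sum_distrib_left[symmetric] by (simp add: c_def power_add)
  finally show ?case .
qed

lemma bij_betw_sign_lists:
  "bij_betw (\<lambda>\<sigma>. map \<sigma> [1..<Suc N]) ({1..N} \<rightarrow>\<^sub>E {1, -1}) (sign_lists N)"
proof (rule bij_betw_byWitness[where f' = "\<lambda>ss. restrict (\<lambda>i. ss ! (i - 1)) {1..N}"])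
  show "\<forall>\<sigma>\<in>{1..N} \<rightarrow>\<^sub>E {1, -1}. restrict (\<lambda>i. map \<sigma> [1..<Suc N] ! (i - 1)) {1..N} = \<sigma>"
    by (auto simp: fun_eq_iff PiE_def extensional_def nth_append simp del: upt_Suc)
  show "\<forall>ss\<in>sign_lists N. map (restrict (\<lambda>i. ss ! (i - 1)) {1..N}) [1..<Suc N] = ss"
    by (auto simp: sign_lists_def intro!: nth_equalityI simp del: upt_Suc)
  show "(\<lambda>\<sigma>. map \<sigma> [1..<Suc N]) ` ({1..N} \<rightarrow>\<^sub>E {1, -1}) \<subseteq> sign_lists N"
  proof (rule image_subsetI)
    fix \<sigma> :: "nat \<Rightarrow> complex" assume \<sigma>: "\<sigma> \<in> {1..N} \<rightarrow>\<^sub>E {1, -1}"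
    have "set (map \<sigma> [1..<Suc N]) = \<sigma> ` {1..N}"
      by (simp only: set_map set_upt atLeastLessThanSuc_atLeastAtMost)
    also have "\<dots> \<subseteq> {1, -1}" using PiE_mem[OF \<sigma>] by (rule image_subsetI)
    finally show "map \<sigma> [1..<Suc N] \<in> sign_lists N"
      by (simp add: sign_lists_def del: upt_Suc)
  qed
  show "(\<lambda>ss. restrict (\<lambda>i. ss ! (i - 1)) {1..N}) ` sign_lists N \<subseteq> {1..N} \<rightarrow>\<^sub>E {1, -1}"
  proof (rule image_subsetI)
    fix ss assume ss: "ss \<in> sign_lists N"
    have "ss ! (i - 1) \<in> {1, -1}" if "i \<in> {1..N}" for i
    proof (rule subsetD)
      show "set ss \<subseteq> {1, -1}" using ss by (simp add: sign_lists_def)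
      show "ss ! (i - 1) \<in> set ss" using ss that by (intro nth_mem) (auto simp: sign_lists_def)
    qed
    then show "restrict (\<lambda>i. ss ! (i - 1)) {1..N} \<in> {1..N} \<rightarrow>\<^sub>E {1, -1}"
      by (simp only: restrict_PiE_iff) blast
  qed
qed

lemma sum_alternating_pairs:
  fixes g :: "nat \<Rightarrow> complex"
  shows "(\<Sum>i<2 * K. (-1) ^ Suc i / of_nat (Suc i) * g (i div 2)) =
         - (\<Sum>j<K. g j / of_nat ((2 * j + 1) * (2 * j + 2)))"
proof (induction K)
  case (Suc K)
  define a b :: complex where "a = of_nat (2 * K + 1)" and "b = of_nat (2 * K + 2)"
  have "a \<noteq> 0" "b \<noteq> 0"
    unfolding a_def b_def of_nat_eq_0_iff by simp_all
  moreover have "b = a + 1" by (simp add: a_def b_def)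
  ultimately have "(-1 / a + 1 / b) * g K = - (g K / (a * b))"
    by (simp add: divide_simps)
  then have "(-1 / of_nat (2 * K + 1) + 1 / of_nat (2 * K + 2)) * g K =
        - (g K / of_nat ((2 * K + 1) * (2 * K + 2)))"
    by (simp only: a_def b_def of_nat_mult)
  then show ?case using Suc by (simp add: algebra_simps)
qed auto

text \<open>Convergence of the whole sequence of truncations is known, so its limit may be computed along even
  truncations, where the terms can be paired.\<close>

lemma sum_signs_Li:
  assumes "composition ks" "ks \<noteq> []"
  obtains r where "(\<lambda>j. mhs ks j / real ((2 * j + 1) * (2 * j + 2))) sums r"
    and "(\<Sum>ss\<in>sign_lists (length ks). Li (1 # ks) (-1 # adjacent_products 1 ss)) =
      - of_real (2 ^ length ks / 2 ^ sum_list ks * r)"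
proof -
  define c :: real where "c = 2 ^ length ks / 2 ^ sum_list ks"
  define S where "S = (\<Sum>ss\<in>sign_lists (length ks). Li (1 # ks) (-1 # adjacent_products 1 ss))"
  define P where "P K = (\<Sum>j<K. mhs ks j / real ((2 * j + 1) * (2 * j + 2)))" for K
  have "(\<lambda>M. \<Sum>ss\<in>sign_lists (length ks). Li_trunc M (1 # ks) (-1 # adjacent_products 1 ss)) \<longlonglongrightarrow> S"
    unfolding S_def
  proof (rule tendsto_sum)
    fix ss assume "ss \<in> sign_lists (length ks)"
    then have "convergent (\<lambda>M. Li_trunc M (1 # ks) (-1 # adjacent_products 1 ss))"
      using set_adjacent_products[of 1 ss] assms
      by (intro convergent_Li_trunc) (auto simp: sign_lists_def)
    then show "(\<lambda>M. Li_trunc M (1 # ks) (-1 # adjacent_products 1 ss)) \<longlonglongrightarrow>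
        Li (1 # ks) (-1 # adjacent_products 1 ss)"
      by (simp add: Li_def convergent_LIMSEQ_iff)
  qed
  then have "(\<lambda>K. \<Sum>ss\<in>sign_lists (length ks). Li_trunc (2 * K) (1 # ks) (-1 # adjacent_products 1 ss)) \<longlonglongrightarrow> S"
    by (rule filterlim_compose) (simp add: filterlim_subseq strict_mono_def)
  also have "(\<lambda>K. \<Sum>ss\<in>sign_lists (length ks). Li_trunc (2 * K) (1 # ks) (-1 # adjacent_products 1 ss)) =
             (\<lambda>K. - of_real (c * P K))"
  proof
    fix K
    have "(\<Sum>ss\<in>sign_lists (length ks). Li_trunc (2 * K) (1 # ks) (-1 # adjacent_products 1 ss)) =
          (\<Sum>i<2 * K. (-1) ^ Suc i / of_nat (Suc i) *
             (\<Sum>ss\<in>sign_lists (length ks). Li_trunc i ks (adjacent_products 1 ss)))"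
      unfolding Li_trunc_Cons sum_distrib_left by (subst sum.swap) simp
    also have "\<dots> = (\<Sum>i<2 * K. (-1) ^ Suc i / of_nat (Suc i) * of_real (c * mhs ks (i div 2)))"
      by (simp add: sum_signs_Li_trunc c_def)
    also have "\<dots> = - (\<Sum>j<K. of_real (c * mhs ks j) / of_nat ((2 * j + 1) * (2 * j + 2)))"
      by (rule sum_alternating_pairs)
    also have "\<dots> = - of_real (c * P K)"
      by (simp add: P_def sum_distrib_left)
    finally show "(\<Sum>ss\<in>sign_lists (length ks). Li_trunc (2 * K) (1 # ks) (-1 # adjacent_products 1 ss)) =
          - of_real (c * P K)" .
  qed
  finally have lim: "(\<lambda>K. - complex_of_real (c * P K)) \<longlonglongrightarrow> S" .
  have "(\<lambda>K. - c * P K) \<longlonglongrightarrow> Re S"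
    using tendsto_Re[OF lim] by simp
  then have "(\<lambda>K. (- c * P K) * (- 1 / c)) \<longlonglongrightarrow> Re S * (- 1 / c)"
    by (rule tendsto_mult_right)
  then have P: "P \<longlonglongrightarrow> Re S * (- 1 / c)"
    by (simp add: c_def)
  then have "(\<lambda>K. - complex_of_real (c * P K)) \<longlonglongrightarrow> - of_real (c * (Re S * (- 1 / c)))"
    by (intro tendsto_intros)
  then have "S = - of_real (c * (Re S * (- 1 / c)))"
    using lim LIMSEQ_unique by blast
  with P show ?thesis
    using that[of "Re S * (- 1 / c)"] unfolding S_def c_def sums_def P_def by blast
qed

section \<open>Zeta values as tails, and the antipode relation\<close>

text \<open>The bound is chosen so that \<open>2 / (n + 1)\<close> reproduces itself exactly: its decrement is
  \<open>2 / ((n + 1) (n + 2))\<close>.\<close>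

lemma tail_le:
  assumes "composition ms" "ms \<noteq> []" "last ms \<ge> 2"
  shows "tail ms n \<le> ennreal (2 / real (Suc n))"
  using assms
proof (induction ms arbitrary: n)
  case (Cons m ms)
  let ?c = "\<lambda>i. 2 / (real (Suc i) * real (Suc (Suc i)))"
  have le: "tail ms (Suc i) * ennreal (1 / real (Suc i) ^ m) \<le> ennreal (?c i)" for i
  proof (cases "ms = []")
    case True
    with Cons.prems have "real (Suc i) ^ 2 \<le> real (Suc i) ^ m"
      by (intro power_increasing) auto
    moreover have "real (Suc i) * real (Suc (Suc i)) \<le> 2 * real (Suc i) ^ 2"
      by (simp add: power2_eq_square algebra_simps)
    ultimately have "real (Suc i) * real (Suc (Suc i)) \<le> 2 * real (Suc i) ^ m" by linarith
    then have "1 / real (Suc i) ^ m \<le> ?c i"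
      by (simp add: field_simps del: of_nat_Suc)
    with True show ?thesis by (simp add: ennreal_leI del: of_nat_Suc)
  next
    case False
    then have "tail ms (Suc i) * ennreal (1 / real (Suc i) ^ m) \<le>
               ennreal (2 / real (Suc (Suc i))) * ennreal (1 / real (Suc i))"
      using Cons.prems Cons.IH[of "Suc i"]
      by (intro mult_mono ennreal_leI inverse_power_le) (auto simp: composition_Cons)
    also have "\<dots> = ennreal (?c i)"
      by (simp add: ennreal_mult'[symmetric] mult.commute del: of_nat_Suc)
    finally show ?thesis .
  qed
  have "tail (m # ms) n \<le> (\<Sum>i. if n \<le> i then ennreal (?c i) else 0)"
    unfolding tail.simps by (intro suminf_le) (use le in auto)
  also have "\<dots> = ennreal (2 / real (Suc n))"
  proof (rule suminf_telescope_from)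
    show "(\<lambda>i. 2 / real (Suc i)) \<longlonglongrightarrow> 0"
      using tendsto_mult_right_zero[OF LIMSEQ_inverse_real_of_nat, of 2]
      by (simp add: divide_inverse)
  qed (simp_all add: field_simps)
  finally show ?case .
qed simp

text \<open>Throughout, the condition \<open>last (2 # ms) \<ge> 2\<close> says that \<open>ms\<close> is empty or has last entry at least 2.\<close>

abbreviation real_tail :: "nat list \<Rightarrow> nat \<Rightarrow> real" where
  "real_tail ms n \<equiv> enn2real (tail ms n)"

lemma ennreal_real_tail:
  assumes "composition ms" "last (2 # ms) \<ge> 2"
  shows "ennreal (real_tail ms n) = tail ms n"
proof (cases "ms = []")
  case False
  then have "tail ms n < top"
    using tail_le[of ms n] assms by (auto intro: le_less_trans)
  then show ?thesis by (simp add: ennreal_enn2real)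
qed simp

lemma sums_real_tail:
  assumes "composition (m # ms)" "last (m # ms) \<ge> 2"
  shows "(\<lambda>i. if n \<le> i then real_tail ms (Suc i) / real (Suc i) ^ m else 0) sums real_tail (m # ms) n"
proof -
  let ?g = "\<lambda>i. if n \<le> i then real_tail ms (Suc i) / real (Suc i) ^ m else 0"
  have ms: "composition ms" "last (2 # ms) \<ge> 2"
    using assms by (auto simp: composition_Cons split: if_splits)
  have "ennreal (?g i) = (if n \<le> i then tail ms (Suc i) * ennreal (1 / real (Suc i) ^ m) else 0)" for i
    using ennreal_mult'[of "1 / real (Suc i) ^ m" "real_tail ms (Suc i)"] ennreal_real_tail[OF ms, of "Suc i"]
    by (simp add: mult.commute)
  then have eq: "(\<Sum>i. ennreal (?g i)) = tail (m # ms) n" by simp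
  moreover have "tail (m # ms) n = ennreal (real_tail (m # ms) n)"
    using assms by (intro ennreal_real_tail[symmetric]) auto
  ultimately have "(\<lambda>i. ennreal (?g i)) sums ennreal (real_tail (m # ms) n)"
    using summable_sums[OF summableI, of "\<lambda>i. ennreal (?g i)"] by simp
  then show ?thesis by (subst (asm) sums_ennreal) auto
qed

definition power_product :: "nat list \<Rightarrow> nat list \<Rightarrow> real" where
  "power_product ks ns = (\<Prod>i<length ks. 1 / real (ns ! i) ^ (ks ! i))"

lemma power_product_nonneg: "power_product ks ns \<ge> 0"
  by (auto simp: power_product_def intro!: prod_nonneg)

lemma power_product_rev:
  "length ns = length ks \<Longrightarrow> power_product (rev ks) (rev ns) = power_product ks ns"
  unfolding power_product_def
  by (subst (2) prod.nat_diff_reindex[symmetric]) (auto simp: rev_nth intro!: prod.cong)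

lemma has_sum_real_tail:
  assumes "composition ms" "last (2 # ms) \<ge> 2"
  shows "(power_product ms has_sum real_tail ms n) (ordered_tuples (<) {n<..} (length ms))"
  using assms
proof (induction ms arbitrary: n)
  case Nil
  show ?case
    using has_sum_finite[of "{[]}" "\<lambda>_ :: nat list. 1 :: real"]
    by (simp add: ordered_tuples_0 power_product_def)
next
  case (Cons m ms)
  then have ms: "composition ms" "last (2 # ms) \<ge> 2" and lst: "last (m # ms) \<ge> 2"
    by (auto simp: composition_Cons split: if_splits)
  let ?g = "\<lambda>i. real_tail ms i / real i ^ m"
  let ?B = "\<lambda>i. ordered_tuples (<) {i<..} (length ms)"
  have "((\<lambda>i. if n \<le> i then ?g (Suc i) else 0) has_sum real_tail (m # ms) n) UNIV"
    by (rule sums_nonneg_imp_has_sum[OF sums_real_tail[OF Cons.prems(1) lst]]) auto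
  then have "((\<lambda>i. ?g (Suc i)) has_sum real_tail (m # ms) n) {n..}"
    by (subst (asm) has_sum_cong_neutral[where T = "{n..}" and g = "\<lambda>i. ?g (Suc i)"]) auto
  moreover have "bij_betw Suc {n..} {n<..}"
    by (rule bij_betw_byWitness[where f' = "\<lambda>i. i - 1"]) auto
  ultimately have g: "(?g has_sum real_tail (m # ms) n) {n<..}"
    by (simp only: has_sum_reindex_bij_betw[of Suc "{n..}" "{n<..}" ?g])
  have inner: "((\<lambda>ns. case_prod (\<lambda>i ns. power_product (m # ms) (i # ns)) (i, ns)) has_sum ?g i) (?B i)" for i
    using has_sum_cmult_right[OF Cons.IH[OF ms, of i], of "1 / real i ^ m"]
    by (simp add: power_product_def prod.lessThan_Suc_shift mult.commute del: prod.lessThan_Suc)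
  have "(case_prod (\<lambda>i ns. power_product (m # ms) (i # ns)) has_sum real_tail (m # ms) n) (Sigma {n<..} ?B)"
    by (rule has_sum_SigmaI[OF inner g], rule summable_on_SigmaI[OF inner])
       (use g in \<open>auto simp: power_product_nonneg simp del: tail.simps intro: has_sum_imp_summable\<close>)
  moreover have "{j \<in> {n<..}. i < j} = {i<..}" if "i \<in> {n<..}" for i
    using that by auto
  then have "ordered_tuples (<) {n<..} (length (m # ms)) = (\<lambda>(i, ns). i # ns) ` Sigma {n<..} ?B"
    by (simp only: list.size(4) add_Suc_right add_0_right ordered_tuples_Suc cong: Sigma_cong)
  ultimately show ?case
    by (simp only: has_sum_reindex[OF inj_on_Cons_pair]) (simp only: o_def case_prod_unfold)
qed

lemma mzv_rev:
  assumes "composition ms" "last (2 # ms) \<ge> 2"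
  shows "mzv (rev ms) = real_tail ms 0"
proof -
  have "bij_betw rev (ordered_tuples (<) {0<..} (length ms)) (ordered_tuples (>) {1..} (length ms))"
    by (rule bij_betw_byWitness[where f' = rev])
       (auto simp: ordered_tuples_def sorted_wrt_rev)
  then have "(\<Sum>\<^sub>\<infinity>ns\<in>ordered_tuples (>) {1..} (length ms). power_product (rev ms) ns) =
        (\<Sum>\<^sub>\<infinity>ns\<in>ordered_tuples (<) {0<..} (length ms). power_product (rev ms) (rev ns))"
    by (rule infsum_reindex_bij_betw[symmetric])
  also have "\<dots> = (\<Sum>\<^sub>\<infinity>ns\<in>ordered_tuples (<) {0<..} (length ms). power_product ms ns)"
    by (intro infsum_cong) (simp add: power_product_rev ordered_tuples_def)
  also have "\<dots> = real_tail ms 0"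
    by (rule infsumI[OF has_sum_real_tail[OF assms]])
  finally show ?thesis
    by (simp add: mzv_def power_product_def[symmetric] ordered_tuples_def
        power_product_def[of "rev ms", simplified, symmetric])
qed

text \<open>Peeling the first entry \<open>m\<close> off all star sums leaves the same relation for the shorter list at each
  \<open>i \<le> n\<close>. By induction these contribute the part with smallest variable at most \<open>n\<close> of the zeta
  value in the term \<open>j = 0\<close>, and the part above \<open>n\<close> remains.\<close>

lemma antipode_tail:
  assumes "composition ms" "last (2 # ms) \<ge> 2"
  shows "(\<Sum>j\<le>length ms. (-1) ^ Suc j * mzv (rev (drop j ms)) * zeta_star n (take j ms)) = - real_tail ms n"
  using assms
proof (induction ms arbitrary: n)
  case Nil
  show ?case using mzv_rev[of "[]"] by (simp add: zeta_star_Nil composition_def)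
next
  case (Cons m ms)
  then have ms: "composition ms" "last (2 # ms) \<ge> 2" and lst: "last (m # ms) \<ge> 2"
    by (auto simp: composition_Cons split: if_splits)
  let ?g = "\<lambda>i. real_tail ms (Suc i) / real (Suc i) ^ m"
  have "(\<lambda>i. (if 0 \<le> i then ?g i else 0) - (if n \<le> i then ?g i else 0)) sums
          (real_tail (m # ms) 0 - real_tail (m # ms) n)"
    by (intro sums_diff sums_real_tail Cons.prems(1) lst)
  moreover have "(\<lambda>i. (if 0 \<le> i then ?g i else 0) - (if n \<le> i then ?g i else 0)) =
      (\<lambda>i. if i \<in> {..<n} then ?g i else 0)" by auto
  ultimately have split: "real_tail (m # ms) 0 - real_tail (m # ms) n = (\<Sum>i<n. ?g i)"
    using sums_If_finite_set[of "{..<n}" ?g] sums_unique2 by fastforce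
  have "(\<Sum>j\<le>length (m # ms). (-1) ^ Suc j * mzv (rev (drop j (m # ms))) * zeta_star n (take j (m # ms))) =
        - real_tail (m # ms) 0 +
        (\<Sum>j\<le>length ms. (-1) ^ Suc (Suc j) * mzv (rev (drop j ms)) * zeta_star n (m # take j ms))"
    using mzv_rev[of "m # ms"] Cons.prems
    by (simp only: list.size(4) add_Suc_right add_0_right sum.atMost_Suc_shift) (simp add: zeta_star_Nil)
  also have "(\<Sum>j\<le>length ms. (-1) ^ Suc (Suc j) * mzv (rev (drop j ms)) * zeta_star n (m # take j ms)) =
      (\<Sum>i<n. - 1 / real (Suc i) ^ m *
        (\<Sum>j\<le>length ms. (-1) ^ Suc j * mzv (rev (drop j ms)) * zeta_star (Suc i) (take j ms)))"
    unfolding zeta_star_Cons sum_distrib_left by (subst sum.swap) (simp add: sum_negf[symmetric])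
  also have "\<dots> = (\<Sum>i<n. ?g i)"
    by (intro sum.cong refl) (simp only: Cons.IH[OF ms], simp)
  finally show ?case using split by simp
qed

section \<open>The identity\<close>

theorem theorem2p3:
  fixes k p N :: nat and ms :: "nat list" and Q :: real
  assumes "k \<ge> 1" and "p \<ge> 1"
    and "length ms = p" and "composition ms" and "last ms \<ge> 2"
    and "N = sum_list ms - p + k - 1"
    and "Q = (\<Sum>j=1..p. (-1) ^ j * mzv (rev (drop (j - 1) ms)) * binom_series k (take (j - 1) ms))
             - (-1) ^ p * binom_series k ms"
  shows "complex_of_real Q =
           2 ^ (p + 1) * (\<Sum>\<sigma>\<in>{1..N} \<rightarrow>\<^sub>E {1, -1 :: complex}.
             Li (hoffman_dual ((k + 1) # butlast ms @ [last ms - 1]))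
                (-1 # \<sigma> 1 # map (\<lambda>i. \<sigma> i * \<sigma> (i + 1)) [1..<N]))
         \<and> complex_of_real Q \<in> CMZV 2 (sum_list ms + k)"
proof -
  have "ms \<noteq> []" using assms(2,3) by auto
  then have ms: "last (2 # ms) \<ge> 2" "last (k # ms) \<ge> 2" "last (Suc k # ms) \<ge> 2"
    using assms(5) by simp_all
  define ks where "ks = hoffman_dual (k # decr_last ms)"
  have decr: "decr_last (Suc k # ms) = Suc k # decr_last ms"
    using \<open>ms \<noteq> []\<close> by (rule decr_last_Cons)
  have comp: "composition (decr_last ms)"
    using composition_decr_last[OF assms(4) ms(3)] by (simp add: decr composition_Cons)
  then have comp': "composition (k # decr_last ms)"
    using assms(1) by (simp add: composition_Cons)
  have dual: "hoffman_dual (Suc k # decr_last ms) = 1 # ks"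
    unfolding ks_def by (rule hoffman_dual_Suc[OF assms(1) comp])
  have ks: "composition ks" "ks \<noteq> []"
    unfolding ks_def using comp' by (auto simp: composition_hoffman_dual hoffman_dual_not_Nil)
  have "ms = butlast ms @ [last ms]" using \<open>ms \<noteq> []\<close> by simp
  then have "sum_list ms = sum_list (butlast ms) + last ms"
    by (metis sum_list.append sum_list.Cons sum_list.Nil add_0_right)
  then have sum_decr: "Suc (sum_list (decr_last ms)) = sum_list ms"
    using assms(5) by (simp add: decr_last_def)
  have sum_ks: "sum_list ks + 1 = sum_list ms + k"
    unfolding ks_def using comp' sum_decr by (simp add: sum_list_hoffman_dual)
  have len_ks: "length ks + p = sum_list ks"
  proof -
    have "length (decr_last ms) = p" using assms(2,3) by (simp add: decr_last_def)
    then show ?thesis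
      using length_hoffman_dual[OF comp'] sum_list_hoffman_dual[OF comp'] by (simp add: ks_def)
  qed
  have "p \<le> sum_list ms"
    using length_hoffman_dual[OF comp] hoffman_dual_not_Nil[OF comp] assms(2,3) sum_decr
    by (cases "hoffman_dual (decr_last ms)") (auto simp: decr_last_def)
  then have N: "N = length ks"
    using len_ks sum_ks assms(1,6) by linarith
  then have "N \<ge> 1" using ks(2) by (simp add: Suc_le_eq)

  obtain r where r: "(\<lambda>j. mhs ks j / real ((2 * j + 1) * (2 * j + 2))) sums r"
    and Li_r: "(\<Sum>ss\<in>sign_lists N. Li (1 # ks) (-1 # adjacent_products 1 ss)) =
      - of_real (2 ^ N / 2 ^ sum_list ks * r)"
    by (rule sum_signs_Li[OF ks, folded N])

  let ?a = "\<lambda>i. central (Suc i) / real (Suc i) ^ k"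
  have binom: "(\<lambda>i. ?a i * zeta_star (Suc i) xs) sums binom_series k xs" if "composition xs" for xs
  proof -
    have "binom_series k xs = (\<Sum>i. ?a i * zeta_star (Suc i) xs)"
      unfolding binom_series_def Let_def central_def by (intro suminf_cong) (simp add: mult_ac)
    then show ?thesis
      using summable_sums[OF summable_binom_series[OF assms(1) that]] by simp
  qed
  \<comment> \<open>The separate term of \<open>Q\<close> continues the sum, with the empty zeta value 1.\<close>
  have Q_sum: "Q = (\<Sum>j\<le>p. (-1) ^ Suc j * mzv (rev (drop j ms)) * binom_series k (take j ms))"
  proof -
    have "(\<Sum>j=1..p. (-1) ^ j * mzv (rev (drop (j - 1) ms)) * binom_series k (take (j - 1) ms)) =
          (\<Sum>j<p. (-1) ^ Suc j * mzv (rev (drop j ms)) * binom_series k (take j ms))"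
      by (simp only: One_nat_def sum.atLeast1_atMost_eq diff_Suc_Suc diff_zero)
    moreover have "mzv [] = 1" using mzv_rev[of "[]"] by (simp add: composition_def)
    ultimately show ?thesis
      unfolding assms(7) lessThan_Suc_atMost[symmetric] sum.lessThan_Suc using assms(3) by simp
  qed
  have "(\<lambda>i. \<Sum>j\<le>p. (-1) ^ Suc j * mzv (rev (drop j ms)) * (?a i * zeta_star (Suc i) (take j ms))) sums Q"
    unfolding Q_sum using assms(4) in_set_takeD
    by (intro sums_sum sums_mult binom) (fastforce simp: composition_def)
  also have "(\<lambda>i. \<Sum>j\<le>p. (-1) ^ Suc j * mzv (rev (drop j ms)) * (?a i * zeta_star (Suc i) (take j ms))) =
             (\<lambda>i. - (?a i * real_tail ms (Suc i)))"
  proof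
    fix i
    have "(\<Sum>j\<le>p. (-1) ^ Suc j * mzv (rev (drop j ms)) * (?a i * zeta_star (Suc i) (take j ms))) =
          ?a i * (\<Sum>j\<le>p. (-1) ^ Suc j * mzv (rev (drop j ms)) * zeta_star (Suc i) (take j ms))"
      unfolding sum_distrib_left by (intro sum.cong) (simp_all only: mult_ac)
    then show "(\<Sum>j\<le>p. (-1) ^ Suc j * mzv (rev (drop j ms)) * (?a i * zeta_star (Suc i) (take j ms))) =
          - (?a i * real_tail ms (Suc i))"
      using antipode_tail[OF assms(4) ms(1), of "Suc i"] assms(3) by simp
  qed
  finally have sums_Q: "(\<lambda>i. ?a i * real_tail ms (Suc i)) sums (- Q)"
    using sums_minus by fastforce

  have "ennreal (- Q) = (\<Sum>i. ennreal (?a i * real_tail ms (Suc i)))"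
    by (rule suminf_ennreal_eq[OF _ sums_Q, symmetric]) (simp add: central_nonneg)
  also have "\<dots> = (\<Sum>i. ennreal (central (Suc i)) * ennreal (1 / real (Suc i) ^ k) * tail ms (Suc i))"
  proof (intro suminf_cong)
    fix i
    have "ennreal (?a i * real_tail ms (Suc i)) =
          ennreal (central (Suc i) * (1 / real (Suc i) ^ k)) * ennreal (real_tail ms (Suc i))"
      by (subst ennreal_mult'[symmetric]) (simp_all add: central_nonneg)
    also have "ennreal (central (Suc i) * (1 / real (Suc i) ^ k)) =
          ennreal (central (Suc i)) * ennreal (1 / real (Suc i) ^ k)"
      by (rule ennreal_mult') (rule central_nonneg)
    finally show "ennreal (?a i * real_tail ms (Suc i)) =
        ennreal (central (Suc i)) * ennreal (1 / real (Suc i) ^ k) * tail ms (Suc i)"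
      unfolding ennreal_real_tail[OF assms(4) ms(1)] .
  qed
  also have "\<dots> = down_sum (connect (\<lambda>n. ennreal (central n))) (1 # ks)"
    unfolding connected_sum_transport[OF assms(4) ms(3), of "\<lambda>n. ennreal (central n)"] decr dual ..
  also have "\<dots> = (\<Sum>j. ennreal (2 * (mhs ks j / real ((2 * j + 1) * (2 * j + 2)))))"
  proof (unfold down_sum_def connect_central, intro suminf_cong)
    fix j
    have "1 / real (2 * j + 1) * (mhs ks j / real (Suc j)) =
          2 * (mhs ks j / real ((2 * j + 1) * (2 * j + 2)))"
    proof -
      have "real ((2 * j + 1) * (2 * j + 2)) = real (2 * j + 1) * (2 * real (Suc j))"
        by (simp add: algebra_simps)
      moreover have "1 / a * (m / s) = 2 * (m / (a * (2 * s)))" for a m s :: real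
        by simp
      ultimately show ?thesis by (simp only:)
    qed
    moreover have "ennreal (1 / real (2 * j + 1)) * ennreal (mhs ks j / real (Suc j)) =
        ennreal (1 / real (2 * j + 1) * (mhs ks j / real (Suc j)))"
      by (rule ennreal_mult'[symmetric]) simp
    ultimately show "ennreal (1 / real (2 * j + 1)) * ennreal (mhs (tl (1 # ks)) j / real (Suc j) ^ hd (1 # ks)) =
      ennreal (2 * (mhs ks j / real ((2 * j + 1) * (2 * j + 2))))"
      by (simp only: list.sel power_one_right)
  qed
  also have "\<dots> = ennreal (2 * r)"
    by (rule suminf_ennreal_eq[OF _ sums_mult[OF r]]) (simp add: mhs_nonneg)
  finally have "ennreal (- Q) = ennreal (2 * r)" .
  moreover have "- Q \<ge> 0"
    using sums_le[OF _ sums_zero sums_Q] by (simp add: central_nonneg)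
  moreover have "r \<ge> 0"
    using sums_le[OF _ sums_zero r] by (simp add: mhs_nonneg)
  ultimately have Q_r: "Q = - (2 * r)" by simp

  have "(\<Sum>\<sigma>\<in>{1..N} \<rightarrow>\<^sub>E {1, -1 :: complex}.
          Li (1 # ks) (-1 # \<sigma> 1 # map (\<lambda>i. \<sigma> i * \<sigma> (i + 1)) [1..<N])) =
        (\<Sum>\<sigma>\<in>{1..N} \<rightarrow>\<^sub>E {1, -1 :: complex}.
          Li (1 # ks) (-1 # adjacent_products 1 (map \<sigma> [1..<Suc N])))"
    using \<open>N \<ge> 1\<close> by (simp only: adjacent_products_map_upt mult_1)
  also have "\<dots> = (\<Sum>ss\<in>sign_lists N. Li (1 # ks) (-1 # adjacent_products 1 ss))"
    by (rule sum.reindex_bij_betw[OF bij_betw_sign_lists])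
  finally have Li_sum: "(\<Sum>\<sigma>\<in>{1..N} \<rightarrow>\<^sub>E {1, -1 :: complex}.
          Li (1 # ks) (-1 # \<sigma> 1 # map (\<lambda>i. \<sigma> i * \<sigma> (i + 1)) [1..<N])) =
        (\<Sum>ss\<in>sign_lists N. Li (1 # ks) (-1 # adjacent_products 1 ss))" .

  \<comment> \<open>The powers of 2 combine to a single factor 2, because the dual without its head has depth \<open>N\<close> and weight \<open>N + p\<close>.\<close>
  have main: "complex_of_real Q = 2 ^ (p + 1) * (\<Sum>ss\<in>sign_lists N. Li (1 # ks) (-1 # adjacent_products 1 ss))"
    unfolding Li_r Q_r by (simp add: len_ks[symmetric] N power_add)
  have mem: "complex_of_real Q \<in> CMZV 2 (sum_list ms + k)"
  proof -
    have "Li (1 # ks) (-1 # adjacent_products 1 ss) \<in> CMZV 2 (sum_list ms + k)"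
      if "ss \<in> sign_lists N" for ss
      unfolding CMZV_def
    proof (intro rat_complex.span_base CollectI exI[of _ "1 # ks"]
        exI[of _ "-1 # adjacent_products 1 ss"] conjI)
      show "\<forall>z\<in>set (-1 # adjacent_products 1 ss). z\<^sup>2 = 1"
        using set_adjacent_products[of 1 ss] that by (auto simp: sign_lists_def)
    qed (use ks sum_ks N that in \<open>auto simp: composition_Cons sign_lists_def\<close>)
    then have "(\<Sum>ss\<in>sign_lists N. Li (1 # ks) (-1 # adjacent_products 1 ss)) \<in> CMZV 2 (sum_list ms + k)"
      unfolding CMZV_def by (rule rat_complex.span_sum)
    then have "of_rat (2 ^ (p + 1)) * (\<Sum>ss\<in>sign_lists N. Li (1 # ks) (-1 # adjacent_products 1 ss))
        \<in> CMZV 2 (sum_list ms + k)"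
      unfolding CMZV_def by (rule rat_complex.span_scale)
    then show ?thesis by (simp add: main of_rat_power of_rat_mult)
  qed
  have "hoffman_dual ((k + 1) # butlast ms @ [last ms - 1]) = 1 # ks"
    using dual by (simp add: decr_last_def)
  with main mem Li_sum show ?thesis by simp
qed

end
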